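(* Let $G$ be an abelian-by-polycyclic group which is of type $\mathrm{FP}_3$ and of type Bredon-$\mathrm{FP}_1$ with respect to the family of all virtually cyclic subgroups of $G$, such that for every element $g\in G$ of infinite order the centralizer $C_G(g)$ is finitely generated. Then $G$ is virtually cyclic.
   Context: $G$ is abelian-by-polycyclic if it has an abelian normal subgroup $A$ with $G/A$ polycyclic. A virtually cyclic group is one with a cyclic subgroup of finite index (finite groups are included). Let $\mathcal{VC}$ be the family of all virtually cyclic subgroups of $G$. The orbit category $\mathcal O_{\mathcal{VC}}G$ has as objects the transitive $G$-sets with stabilizers in $\mathcal{VC}$ and as morphisms the $G$-maps. An $\mathcal O_{\mathcal{VC}}G$-module is a contravariant functor from $\mathcal O_{\mathcal{VC}}G$ to abelian groups; exactness is defined pointwise. For a $G$-set $\Omega$ with stabilizers in $\mathcal{VC}$, $\mathbb Z[-,\Omega]$ is the $\mathcal O_{\mathcal{VC}}G$-module sending $\Delta$ to the free abelian group on the set of $G$-maps $\Delta\to\Omega$. A projective module is finitely generated if it is a direct summand of $\mathbb Z[-,\Omega]$ for some $\Omega$ with finitely many $G$-orbits and stabilizers in $\mathcal{VC}$. $G$ is of type Bredon-$\mathrm{FP}_n$ with respect to $\mathcal{VC}$ if the constant functor $\mathbb Z$ has a projective resolution $P_*$ over $\mathcal O_{\mathcal{VC}}G$ with $P_i$ finitely generated for all $i\le n$. Type $\mathrm{FP}_n$ for a group $H$ is the usual notion for the trivial $\mathbb ZH$-module $\mathbb Z$. *)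

theory Defs
  imports "HOL-Algebra.Algebra"
begin

section \<open>Group-theoretic notions\<close>

definition virtually_cyclic :: "'a monoid \<Rightarrow> bool" where
  "virtually_cyclic G \<longleftrightarrow>
    (\<exists>C. subgroup C G \<and> cyclic_group (G\<lparr>carrier := C\<rparr>) \<and> finite (rcosets\<^bsub>G\<^esub> C))"

definition VC :: "'a monoid \<Rightarrow> 'a set set" where
  "VC G = {H. subgroup H G \<and> virtually_cyclic (G\<lparr>carrier := H\<rparr>)}"

definition polycyclic :: "'a monoid \<Rightarrow> bool" where
  "polycyclic G \<longleftrightarrow>
    (\<exists>n (H :: nat \<Rightarrow> 'a set). H 0 = {\<one>\<^bsub>G\<^esub>} \<and> H n = carrier G \<and>
      (\<forall>i\<le>n. subgroup (H i) G) \<and>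
      (\<forall>i<n. H i \<lhd> (G\<lparr>carrier := H (Suc i)\<rparr>) \<and>
             cyclic_group (G\<lparr>carrier := H (Suc i)\<rparr> Mod H i)))"

definition abelian_by_polycyclic :: "'a monoid \<Rightarrow> bool" where
  "abelian_by_polycyclic G \<longleftrightarrow>
    (\<exists>A. A \<lhd> G \<and> comm_group (G\<lparr>carrier := A\<rparr>) \<and> polycyclic (G Mod A))"

definition centralizer :: "'a monoid \<Rightarrow> 'a \<Rightarrow> 'a set" where
  "centralizer G g = {h \<in> carrier G. h \<otimes>\<^bsub>G\<^esub> g = g \<otimes>\<^bsub>G\<^esub> h}"

definition fin_gen_subgroup :: "'a set \<Rightarrow> 'a monoid \<Rightarrow> bool" where
  "fin_gen_subgroup H G \<longleftrightarrow> (\<exists>S. finite S \<and> S \<subseteq> carrier G \<and> generate G S = H)"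


section \<open>Modules over a ring and type FP\<close>

text \<open>The library's locale \<open>module\<close> is restricted to commutative rings; only its record
  type is reused here. Its fields \<open>mult\<close> and \<open>one\<close> play no role.\<close>

locale left_module = R?: ring R + M?: abelian_group M
    for R :: "('r, 'k) ring_scheme" (structure) and M :: "('r, 'm, 'l) module_scheme" (structure) +
  assumes smult_closed:
      "\<lbrakk>a \<in> carrier R; x \<in> carrier M\<rbrakk> \<Longrightarrow> a \<odot>\<^bsub>M\<^esub> x \<in> carrier M"
    and smult_l_distr:
      "\<lbrakk>a \<in> carrier R; b \<in> carrier R; x \<in> carrier M\<rbrakk> \<Longrightarrow>
        (a \<oplus>\<^bsub>R\<^esub> b) \<odot>\<^bsub>M\<^esub> x = a \<odot>\<^bsub>M\<^esub> x \<oplus>\<^bsub>M\<^esub> b \<odot>\<^bsub>M\<^esub> x"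
    and smult_r_distr:
      "\<lbrakk>a \<in> carrier R; x \<in> carrier M; y \<in> carrier M\<rbrakk> \<Longrightarrow>
        a \<odot>\<^bsub>M\<^esub> (x \<oplus>\<^bsub>M\<^esub> y) = a \<odot>\<^bsub>M\<^esub> x \<oplus>\<^bsub>M\<^esub> a \<odot>\<^bsub>M\<^esub> y"
    and smult_assoc:
      "\<lbrakk>a \<in> carrier R; b \<in> carrier R; x \<in> carrier M\<rbrakk> \<Longrightarrow>
        (a \<otimes>\<^bsub>R\<^esub> b) \<odot>\<^bsub>M\<^esub> x = a \<odot>\<^bsub>M\<^esub> (b \<odot>\<^bsub>M\<^esub> x)"
    and smult_one: "x \<in> carrier M \<Longrightarrow> \<one>\<^bsub>R\<^esub> \<odot>\<^bsub>M\<^esub> x = x"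

definition lmod_hom ::
    "'r ring \<Rightarrow> ('r, 'm) module \<Rightarrow> ('r, 'n) module \<Rightarrow> ('m \<Rightarrow> 'n) set" where
  "lmod_hom R M N = {f \<in> carrier M \<rightarrow> carrier N.
     (\<forall>x\<in>carrier M. \<forall>y\<in>carrier M. f (x \<oplus>\<^bsub>M\<^esub> y) = f x \<oplus>\<^bsub>N\<^esub> f y) \<and>
     (\<forall>r\<in>carrier R. \<forall>x\<in>carrier M. f (r \<odot>\<^bsub>M\<^esub> x) = r \<odot>\<^bsub>N\<^esub> f x)}"

definition lmod_iso ::
    "'r ring \<Rightarrow> ('r, 'm) module \<Rightarrow> ('r, 'n) module \<Rightarrow> ('m \<Rightarrow> 'n) set" where
  "lmod_iso R M N = {f \<in> lmod_hom R M N. bij_betw f (carrier M) (carrier N)}"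

definition lmod_sum ::
    "('r, 'm) module \<Rightarrow> ('r, 'n) module \<Rightarrow> ('r, 'm \<times> 'n) module" where
  "lmod_sum M N =
    \<lparr>carrier = carrier M \<times> carrier N, monoid.mult = undefined, monoid.one = undefined,
     ring.zero = (\<zero>\<^bsub>M\<^esub>, \<zero>\<^bsub>N\<^esub>), ring.add = (\<lambda>(x, y) (x', y'). (x \<oplus>\<^bsub>M\<^esub> x', y \<oplus>\<^bsub>N\<^esub> y')),
     smult = (\<lambda>r (x, y). (r \<odot>\<^bsub>M\<^esub> x, r \<odot>\<^bsub>N\<^esub> y))\<rparr>"

definition free_lmod :: "'r ring \<Rightarrow> 'b set \<Rightarrow> ('r, 'b \<Rightarrow> 'r) module" where
  "free_lmod R B =
    \<lparr>carrier = {f. (\<forall>x. f x \<in> carrier R) \<and> (\<forall>x. x \<notin> B \<longrightarrow> f x = \<zero>\<^bsub>R\<^esub>) \<and>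
                   finite {x. f x \<noteq> \<zero>\<^bsub>R\<^esub>}},
     monoid.mult = undefined, monoid.one = undefined,
     ring.zero = (\<lambda>x. \<zero>\<^bsub>R\<^esub>), ring.add = (\<lambda>f g x. f x \<oplus>\<^bsub>R\<^esub> g x),
     smult = (\<lambda>r f x. r \<otimes>\<^bsub>R\<^esub> f x)\<rparr>"

text \<open>Projective modules are the direct summands of free modules. The complement \<open>Q\<close> may be
  taken inside the free module, so fixing the type of its elements is no restriction. The type
  \<open>'b\<close> of basis elements is a parameter.\<close>

definition lmod_projective ::
    "'b itself \<Rightarrow> 'r ring \<Rightarrow> ('r, 'm) module \<Rightarrow> bool" where
  "lmod_projective (_ :: 'b itself) R P \<longleftrightarrow> left_module R P \<and>
    (\<exists>(B :: 'b set) (Q :: ('r, 'b \<Rightarrow> 'r) module).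
       left_module R Q \<and> lmod_iso R (lmod_sum P Q) (free_lmod R B) \<noteq> {})"

definition lmod_fin_gen :: "'r ring \<Rightarrow> ('r, 'm) module \<Rightarrow> bool" where
  "lmod_fin_gen R M \<longleftrightarrow>
    (\<exists>S. finite S \<and> S \<subseteq> carrier M \<and> (\<forall>N. submodule N R M \<and> S \<subseteq> N \<longrightarrow> N = carrier M))"

text \<open>
  \<open>lmod_FP TYPE('m) TYPE('b) R M n\<close>: there is a projective resolution
  \<open>\<dots> \<rightarrow> P 1 \<rightarrow> P 0 \<rightarrow> M \<rightarrow> 0\<close> with \<open>P i\<close> finitely generated for \<open>i \<le> n\<close>, such that the elements
  of the \<open>P i\<close> live in \<open>'m\<close> and the bases of the free modules involved in \<open>'b\<close>. Being of type FP
  is the existence of \<open>'m\<close> and \<open>'b\<close> for which this holds; as HOL cannot quantify over types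
  inside a formula, hypotheses of this kind leave \<open>'m\<close> and \<open>'b\<close> as type variables.
\<close>

definition lmod_FP ::
    "'m itself \<Rightarrow> 'b itself \<Rightarrow> 'r ring \<Rightarrow> ('r, 'z) module \<Rightarrow> nat \<Rightarrow> bool" where
  "lmod_FP (_ :: 'm itself) (b :: 'b itself) R M n \<longleftrightarrow>
    (\<exists>(P :: nat \<Rightarrow> ('r, 'm) module) d \<epsilon>.
       (\<forall>i. lmod_projective b R (P i)) \<and>
       (\<forall>i\<le>n. lmod_fin_gen R (P i)) \<and>
       \<epsilon> \<in> lmod_hom R (P 0) M \<and>
       (\<forall>i. d i \<in> lmod_hom R (P (Suc i)) (P i)) \<and>
       \<epsilon> ` carrier (P 0) = carrier M \<and>
       d 0 ` carrier (P 1) = a_kernel (P 0) M \<epsilon> \<and>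
       (\<forall>i. d (Suc i) ` carrier (P (Suc (Suc i))) = a_kernel (P (Suc i)) (P i) (d i)))"

text \<open>The integral group ring: its additive group is \<open>free_Abelian_group (carrier G)\<close>, and
  \<open>frag_extend\<close> is used twice to extend the multiplication of \<open>G\<close> bilinearly.\<close>

definition group_ring :: "'a monoid \<Rightarrow> ('a \<Rightarrow>\<^sub>0 int) ring" where
  "group_ring G =
    \<lparr>carrier = {a. Poly_Mapping.keys a \<subseteq> carrier G},
     monoid.mult = (\<lambda>a b. frag_extend (\<lambda>x. frag_extend (\<lambda>y. frag_of (x \<otimes>\<^bsub>G\<^esub> y)) b) a),
     monoid.one = frag_of \<one>\<^bsub>G\<^esub>, ring.zero = 0, ring.add = (+)\<rparr>"

text \<open>The trivial module: scalars act through the augmentation, the sum of the coefficients.\<close>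

definition trivial_lmod :: "('a \<Rightarrow>\<^sub>0 int, int) module" where
  "trivial_lmod =
    \<lparr>carrier = UNIV, monoid.mult = (*), monoid.one = 1, ring.zero = 0, ring.add = (+),
     smult = (\<lambda>a k. (\<Sum>x\<in>Poly_Mapping.keys a. Poly_Mapping.lookup a x) * k)\<rparr>"

definition group_FP :: "'m itself \<Rightarrow> 'b itself \<Rightarrow> 'a monoid \<Rightarrow> nat \<Rightarrow> bool" where
  "group_FP m b G n \<longleftrightarrow> lmod_FP m b (group_ring G) trivial_lmod n"


section \<open>Modules over the orbit category and type Bredon-FP\<close>

text \<open>A G-set is given by its carrier and its action. As in \<open>group_action\<close>, the bijection by
  which a group element acts is extensional on the carrier.\<close>

type_synonym ('a, 'x) gset = "'x set \<times> ('a \<Rightarrow> 'x \<Rightarrow> 'x)"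

definition gsets :: "'a monoid \<Rightarrow> 'a set set \<Rightarrow> ('a, 'x) gset set" where
  "gsets G F = {(E, \<phi>). group_action G E \<phi> \<and> (\<forall>x\<in>E. stabilizer G \<phi> x \<in> F)}"

definition gmaps :: "'a monoid \<Rightarrow> ('a, 'x) gset \<Rightarrow> ('a, 'y) gset \<Rightarrow> ('x \<Rightarrow> 'y) set" where
  "gmaps G = (\<lambda>(E, \<phi>) (E', \<phi>').
     {f \<in> E \<rightarrow>\<^sub>E E'. \<forall>g\<in>carrier G. \<forall>x\<in>E. f (\<phi> g x) = \<phi>' g (f x)})"

text \<open>Objects of the orbit category with respect to a family \<open>F\<close> of subgroups. Every transitive
  G-set is isomorphic to a set of cosets, so it suffices to let the underlying sets range over the
  subsets of the type \<open>'a set\<close>. Since \<open>transitive_action\<close> admits the empty set, that is excluded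
  explicitly. The morphisms are given by \<open>gmaps\<close>.\<close>

type_synonym 'a orb = "('a, 'a set) gset"

definition orb_objs :: "'a monoid \<Rightarrow> 'a set set \<Rightarrow> 'a orb set" where
  "orb_objs G F = {(E, \<phi>) \<in> gsets G F. transitive_action G E \<phi> \<and> E \<noteq> {}}"

text \<open>Contravariant functors to abelian groups (written multiplicatively, as always for the record
  type \<open>monoid\<close>): for \<open>f : \<Delta> \<rightarrow> \<Delta>'\<close>, \<open>orb_map M \<Delta> \<Delta>' f\<close> goes from
  \<open>orb_at M \<Delta>'\<close> to \<open>orb_at M \<Delta>\<close>.\<close>

record ('a, 'm) orb_module =
  orb_at :: "'a orb \<Rightarrow> 'm monoid"
  orb_map :: "'a orb \<Rightarrow> 'a orb \<Rightarrow> ('a set \<Rightarrow> 'a set) \<Rightarrow> 'm \<Rightarrow> 'm"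

definition is_orb_module :: "'a monoid \<Rightarrow> 'a set set \<Rightarrow> ('a, 'm) orb_module \<Rightarrow> bool" where
  "is_orb_module G F M \<longleftrightarrow>
    (\<forall>\<Delta>\<in>orb_objs G F. comm_group (orb_at M \<Delta>)) \<and>
    (\<forall>\<Delta>\<in>orb_objs G F. \<forall>\<Delta>'\<in>orb_objs G F. \<forall>f\<in>gmaps G \<Delta> \<Delta>'.
       orb_map M \<Delta> \<Delta>' f \<in> hom (orb_at M \<Delta>') (orb_at M \<Delta>)) \<and>
    (\<forall>\<Delta>\<in>orb_objs G F. \<forall>m\<in>carrier (orb_at M \<Delta>). orb_map M \<Delta> \<Delta> (\<lambda>x\<in>fst \<Delta>. x) m = m) \<and>
    (\<forall>\<Delta>\<in>orb_objs G F. \<forall>\<Delta>'\<in>orb_objs G F. \<forall>\<Delta>''\<in>orb_objs G F.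
       \<forall>f\<in>gmaps G \<Delta> \<Delta>'. \<forall>f'\<in>gmaps G \<Delta>' \<Delta>''. \<forall>m\<in>carrier (orb_at M \<Delta>'').
         orb_map M \<Delta> \<Delta>'' (compose (fst \<Delta>) f' f) m =
         orb_map M \<Delta> \<Delta>' f (orb_map M \<Delta>' \<Delta>'' f' m))"

definition orb_hom :: "'a monoid \<Rightarrow> 'a set set \<Rightarrow>
    ('a, 'm) orb_module \<Rightarrow> ('a, 'n) orb_module \<Rightarrow> ('a orb \<Rightarrow> 'm \<Rightarrow> 'n) set" where
  "orb_hom G F M N =
    {\<eta>. (\<forall>\<Delta>\<in>orb_objs G F. \<eta> \<Delta> \<in> hom (orb_at M \<Delta>) (orb_at N \<Delta>)) \<and>
        (\<forall>\<Delta>\<in>orb_objs G F. \<forall>\<Delta>'\<in>orb_objs G F. \<forall>f\<in>gmaps G \<Delta> \<Delta>'. \<forall>m\<in>carrier (orb_at M \<Delta>').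
           \<eta> \<Delta> (orb_map M \<Delta> \<Delta>' f m) = orb_map N \<Delta> \<Delta>' f (\<eta> \<Delta>' m))}"

definition orb_iso :: "'a monoid \<Rightarrow> 'a set set \<Rightarrow>
    ('a, 'm) orb_module \<Rightarrow> ('a, 'n) orb_module \<Rightarrow> ('a orb \<Rightarrow> 'm \<Rightarrow> 'n) set" where
  "orb_iso G F M N =
    {\<eta> \<in> orb_hom G F M N.
       \<forall>\<Delta>\<in>orb_objs G F. bij_betw (\<eta> \<Delta>) (carrier (orb_at M \<Delta>)) (carrier (orb_at N \<Delta>))}"

definition orb_sum ::
    "('a, 'm) orb_module \<Rightarrow> ('a, 'n) orb_module \<Rightarrow> ('a, 'm \<times> 'n) orb_module" where
  "orb_sum M N =
    \<lparr>orb_at = (\<lambda>\<Delta>. orb_at M \<Delta> \<times>\<times> orb_at N \<Delta>),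
     orb_map = (\<lambda>\<Delta> \<Delta>' f. map_prod (orb_map M \<Delta> \<Delta>' f) (orb_map N \<Delta> \<Delta>' f))\<rparr>"

definition orb_const_Z :: "('a, int) orb_module" where
  "orb_const_Z = \<lparr>orb_at = (\<lambda>\<Delta>. integer_group), orb_map = (\<lambda>\<Delta> \<Delta>' f m. m)\<rparr>"

text \<open>The module \<open>\<int>[-, \<Omega>]\<close>.\<close>

definition orb_free ::
    "'a monoid \<Rightarrow> ('a, 'w) gset \<Rightarrow> ('a, ('a set \<Rightarrow> 'w) \<Rightarrow>\<^sub>0 int) orb_module" where
  "orb_free G \<Omega> =
    \<lparr>orb_at = (\<lambda>\<Delta>. free_Abelian_group (gmaps G \<Delta> \<Omega>)),
     orb_map = (\<lambda>\<Delta> \<Delta>' f. frag_extend (\<lambda>h. frag_of (compose (fst \<Delta>) h f)))\<rparr>"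

definition orb_summand_of_free ::
    "'a monoid \<Rightarrow> 'a set set \<Rightarrow> ('a, 'm) orb_module \<Rightarrow> ('a, 'w) gset \<Rightarrow> bool" where
  "orb_summand_of_free G F P \<Omega> \<longleftrightarrow> is_orb_module G F P \<and>
    (\<exists>Q :: ('a, ('a set \<Rightarrow> 'w) \<Rightarrow>\<^sub>0 int) orb_module.
       is_orb_module G F Q \<and> orb_iso G F (orb_sum P Q) (orb_free G \<Omega>) \<noteq> {})"

definition orb_projective ::
    "'w itself \<Rightarrow> 'a monoid \<Rightarrow> 'a set set \<Rightarrow> ('a, 'm) orb_module \<Rightarrow> bool" where
  "orb_projective (_ :: 'w itself) G F P \<longleftrightarrow>
    (\<exists>\<Omega> :: ('a, 'w) gset. \<Omega> \<in> gsets G F \<and> orb_summand_of_free G F P \<Omega>)"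

definition orb_fin_gen_projective ::
    "'w itself \<Rightarrow> 'a monoid \<Rightarrow> 'a set set \<Rightarrow> ('a, 'm) orb_module \<Rightarrow> bool" where
  "orb_fin_gen_projective (_ :: 'w itself) G F P \<longleftrightarrow>
    (\<exists>\<Omega> :: ('a, 'w) gset. \<Omega> \<in> gsets G F \<and> finite (orbits G (fst \<Omega>) (snd \<Omega>)) \<and>
       orb_summand_of_free G F P \<Omega>)"

text \<open>As for \<open>lmod_FP\<close>, the types \<open>'m\<close> of module elements and \<open>'w\<close> of points of the G-sets
  \<open>\<Omega>\<close> are parameters.\<close>

definition bredon_FP ::
    "'m itself \<Rightarrow> 'w itself \<Rightarrow> 'a monoid \<Rightarrow> 'a set set \<Rightarrow> nat \<Rightarrow> bool" where
  "bredon_FP (_ :: 'm itself) (w :: 'w itself) G F n \<longleftrightarrow>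
    (\<exists>(P :: nat \<Rightarrow> ('a, 'm) orb_module) d \<epsilon>.
       (\<forall>i. orb_projective w G F (P i)) \<and>
       (\<forall>i\<le>n. orb_fin_gen_projective w G F (P i)) \<and>
       \<epsilon> \<in> orb_hom G F (P 0) orb_const_Z \<and>
       (\<forall>i. d i \<in> orb_hom G F (P (Suc i)) (P i)) \<and>
       (\<forall>\<Delta>\<in>orb_objs G F.
          \<epsilon> \<Delta> ` carrier (orb_at (P 0) \<Delta>) = carrier (orb_at orb_const_Z \<Delta>) \<and>
          d 0 \<Delta> ` carrier (orb_at (P 1) \<Delta>) =
            kernel (orb_at (P 0) \<Delta>) (orb_at orb_const_Z \<Delta>) (\<epsilon> \<Delta>) \<and>
          (\<forall>i. d (Suc i) \<Delta> ` carrier (orb_at (P (Suc (Suc i))) \<Delta>) =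
             kernel (orb_at (P (Suc i)) \<Delta>) (orb_at (P i) \<Delta>) (d i \<Delta>))))"

end

theory Submission
  imports Defs
begin

text \<open>
  Call a group conjugation-covered if it has finitely many virtually cyclic subgroups such that every
  element is conjugate into one of them. The theorem rests on two facts.

  A group of type Bredon-FP with respect to its virtually cyclic subgroups is conjugation-covered
  (\<open>conj_covered_of_bredon_FP\<close>). The module \<open>P 0\<close> is a summand of some \<open>\<int>[-, \<Omega>]\<close> with finitely many
  orbits in \<open>\<Omega>\<close>, and it maps onto \<open>\<int>\<close> at every object, in particular at \<open>G/\<langle>g\<rangle>\<close>. So there is a
  G-map from \<open>G/\<langle>g\<rangle>\<close> to \<open>\<Omega>\<close>, that is, \<open>g\<close> fixes a point of \<open>\<Omega>\<close>; the stabilizers of orbit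
  representatives are the subgroups wanted.

  A conjugation-covered solvable group is virtually cyclic (\<open>conj_covered_solvable\<close>), and
  abelian-by-polycyclic groups are solvable. As the property
  passes to quotients, one can climb the derived series, and everything happens in one step: \<open>A\<close> is
  an abelian normal subgroup of \<open>G\<close>, and \<open>\<langle>c\<rangle>A\<close> has finite index. Conjugation by \<open>c\<close> is an
  automorphism \<open>M\<close> of \<open>A\<close>, and the covering of \<open>G\<close> shows that \<open>A\<close> is the union of the images under
  powers of \<open>M\<close> of finitely many cosets of cyclic subgroups.

  If a positive power of \<open>c\<close> lies in \<open>A\<close>, then \<open>M\<close> has finite order, \<open>A\<close> is itself a finite union of
  cosets of cyclic subgroups, and a single cyclic subgroup suffices (\<open>cyclic_cosets_cover\<close>).

  Otherwise \<open>A\<close> turns out to be finite. A virtually cyclic subgroup with an element of \<open>Ac\<^sup>k\<close>,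
  \<open>k \<noteq> 0\<close>, meets \<open>A\<close> in torsion elements. If \<open>L\<close> is a common multiple of suitable such exponents
  \<open>k\<close>, one for each subgroup of the family that has one, then every element of \<open>Ac\<^bsup>Lq\<^esup>\<close> is, up to torsion of \<open>A\<close>, the \<open>q\<close>-th
  power of an element of \<open>Ac\<^sup>L\<close>. Comparing the parts in \<open>A\<close>: modulo torsion every \<open>b\<close> in \<open>A\<close> is a norm
  \<open>a \<cdot> M\<^sup>L a \<cdots> M\<^bsup>L(q-1)\<^esup> a\<close>, for every \<open>q\<close> (\<open>norms_onto\<close>). Now \<open>M\<close> acts on \<open>A/A\<^sup>p\<close> with some finite
  order \<open>r\<close> (\<open>bounded_period\<close>), so the norm for \<open>q = rp\<close> is a \<open>p\<close>-th power and \<open>A = TA\<^sup>p\<close>, where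
  \<open>T\<close> is the torsion subgroup. As this holds for all primes \<open>p\<close>, an element of infinite order would
  have a power that, up to powers of \<open>M\<close>, is a \<open>p\<close>-th power in one of finitely many cyclic groups,
  for all \<open>p\<close>; comparing exponents excludes this (\<open>torsion_of_cyclic_divisors\<close>). Hence \<open>A = T\<close>,
  and then \<open>A\<close> is finite, because \<open>M\<close> has finite order on it and finitely many orbits.
  So \<open>\<langle>c\<rangle>\<close> itself has finite index.
\<close>

section \<open>Cancellation in groups\<close>

lemma (in group) int_pow_divmod:
  assumes "x \<in> carrier G"
  shows "x [^] (n::int) = x [^] (n mod w) \<otimes> (x [^] w) [^] (n div w)"
proof -
  have "(x [^] w) [^] (n div w) = x [^] (w * (n div w))" using assms by (rule int_pow_pow)
  then have "x [^] (n mod w) \<otimes> (x [^] w) [^] (n div w) = x [^] (n mod w + w * (n div w))"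
    using assms by (simp only: int_pow_mult)
  also have "n mod w + w * (n div w) = n" by (rule mod_mult_div_eq)
  finally show ?thesis ..
qed

lemma (in comm_group) mult_inv_cancel:
  assumes "x \<in> carrier G" "y \<in> carrier G"
  shows "x \<otimes> y \<otimes> inv x = y"
  using assms by (simp add: m_comm[of x y] m_assoc)

lemma (in comm_group) mult_inv_mult:
  assumes "s \<in> carrier G" "x \<in> carrier G" "y \<in> carrier G"
  shows "(s \<otimes> x) \<otimes> inv (s \<otimes> y) = x \<otimes> inv y"
proof -
  have "(s \<otimes> x) \<otimes> inv (s \<otimes> y) = (s \<otimes> inv s) \<otimes> (x \<otimes> inv y)"
    using assms by (simp only: inv_mult m_ac inv_closed m_closed)
  then show ?thesis using assms by simp
qed

lemma (in group) mult_inv_cancel_left: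
  assumes "x \<in> carrier G" "y \<in> carrier G"
  shows "inv x \<otimes> (x \<otimes> y) = y" "x \<otimes> (inv x \<otimes> y) = y"
  using assms by (simp_all add: m_assoc[symmetric])

lemma (in group) int_pow_diff_left:
  assumes "x \<in> carrier G"
  shows "inv (x [^] (m::int)) \<otimes> x [^] (n::int) = x [^] (n - m)"
  using int_pow_mult[OF assms, of "- m" n] assms by (simp add: int_pow_neg)

lemma (in group) inv_mult_mult:
  assumes "r \<in> carrier G" "x \<in> carrier G" "y \<in> carrier G"
  shows "inv (r \<otimes> x) \<otimes> (r \<otimes> y) = inv x \<otimes> y"
proof -
  have "inv (r \<otimes> x) \<otimes> (r \<otimes> y) = inv x \<otimes> (inv r \<otimes> r) \<otimes> y"
    using assms by (simp only: inv_mult_group m_assoc inv_closed m_closed)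
  then show ?thesis using assms by simp
qed

section \<open>Abelian groups with an automorphism\<close>

text \<open>An automorphism is given by all of its powers \<open>M j\<close>, so that no inverse has to be formed.\<close>

locale int_module = comm_group A for A (structure) +
  fixes M :: "int \<Rightarrow> 'a \<Rightarrow> 'a"
  assumes M_closed [simp, intro]: "x \<in> carrier A \<Longrightarrow> M j x \<in> carrier A"
    and M_mult: "\<lbrakk>x \<in> carrier A; y \<in> carrier A\<rbrakk> \<Longrightarrow> M j (x \<otimes> y) = M j x \<otimes> M j y"
    and M_add: "x \<in> carrier A \<Longrightarrow> M (i + j) x = M i (M j x)"
    and M_0: "x \<in> carrier A \<Longrightarrow> M 0 x = x"
begin

lemma M_hom: "M j \<in> hom A A"
  by (auto simp: hom_def M_mult)

lemma M_one [simp]: "M j \<one> = \<one>"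
  using M_hom by (metis hom_one is_group)

lemma M_inv: "x \<in> carrier A \<Longrightarrow> M j (inv x) = inv (M j x)"
  using M_hom group_hom.hom_inv[of A A "M j" x] by (simp add: group_hom_def group_hom_axioms_def is_group)

lemma M_pow: "x \<in> carrier A \<Longrightarrow> M j (x [^] (n::int)) = M j x [^] n"
  using M_hom group_hom.hom_int_pow[of A A "M j" x] by (simp add: group_hom_def group_hom_axioms_def is_group)

lemma M_minus [simp]: "x \<in> carrier A \<Longrightarrow> M (- j) (M j x) = x"
  using M_add[of x "-j" j] M_0 by simp

lemma M_minus' [simp]: "x \<in> carrier A \<Longrightarrow> M j (M (- j) x) = x"
  using M_add[of x "j" "-j"] M_0 by simp

definition submod :: "'a set \<Rightarrow> bool" where
  "submod U \<longleftrightarrow> subgroup U A \<and> (\<forall>j. \<forall>x\<in>U. M j x \<in> U)"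

definition cong_mod :: "'a set \<Rightarrow> 'a \<Rightarrow> 'a \<Rightarrow> bool" where
  "cong_mod U x y \<longleftrightarrow> x \<otimes> inv y \<in> U"

context
  fixes U assumes U: "submod U"
begin

lemma sub_U: "subgroup U A" using U by (simp add: submod_def)

lemma cong_mod_refl: "x \<in> carrier A \<Longrightarrow> cong_mod U x x"
  using sub_U by (simp add: cong_mod_def subgroup.one_closed)

lemma cong_mod_sym: "\<lbrakk>x \<in> carrier A; y \<in> carrier A; cong_mod U x y\<rbrakk> \<Longrightarrow> cong_mod U y x"
  using subgroup.m_inv_closed[OF sub_U, of "x \<otimes> inv y"] by (simp add: cong_mod_def inv_mult m_comm)

lemma cong_mod_trans:
  assumes "x \<in> carrier A" "y \<in> carrier A" "z \<in> carrier A" "cong_mod U x y" "cong_mod U y z"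
  shows "cong_mod U x z"
proof -
  have "x \<otimes> inv z = (x \<otimes> inv y) \<otimes> (y \<otimes> inv z)"
    using assms(1-3) by (simp add: m_assoc) (metis inv_closed inv_solve_left m_closed)
  then show ?thesis using subgroup.m_closed[OF sub_U] assms by (simp add: cong_mod_def)
qed

lemma cong_mod_mult:
  assumes "x \<in> carrier A" "y \<in> carrier A" "x' \<in> carrier A" "y' \<in> carrier A" "cong_mod U x y" "cong_mod U x' y'"
  shows "cong_mod U (x \<otimes> x') (y \<otimes> y')"
proof -
  have "(x \<otimes> x') \<otimes> inv (y \<otimes> y') = (x \<otimes> inv y) \<otimes> (x' \<otimes> inv y')"
    using assms(1-4) by (simp add: inv_mult m_ac)
  then show ?thesis using subgroup.m_closed[OF sub_U] assms by (simp add: cong_mod_def)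
qed

lemma cong_mod_M:
  assumes "x \<in> carrier A" "y \<in> carrier A" "cong_mod U x y"
  shows "cong_mod U (M j x) (M j y)"
  using assms U by (metis M_inv M_mult cong_mod_def inv_closed submod_def)

lemma cong_mod_M_iff:
  assumes "x \<in> carrier A" "y \<in> carrier A"
  shows "cong_mod U (M j x) (M j y) \<longleftrightarrow> cong_mod U x y"
  using cong_mod_M[OF assms] cong_mod_M[of "M j x" "M j y" "-j"] assms by auto

lemma cong_mod_cancel:
  assumes "x \<in> carrier A" "y \<in> carrier A" "z \<in> carrier A" "cong_mod U (x \<otimes> z) (y \<otimes> z)"
  shows "cong_mod U x y"
  using cong_mod_mult[OF _ _ _ _ assms(4) cong_mod_refl[of "inv z"]] assms by (simp add: m_assoc)

lemma cong_mod_in: "\<lbrakk>x \<in> carrier A; y \<in> carrier A; cong_mod U x y; subgroup Z A; U \<subseteq> Z; y \<in> Z\<rbrakk> \<Longrightarrow> x \<in> Z"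
  unfolding cong_mod_def using subgroup.m_closed[of Z A "x \<otimes> inv y" y] by (auto simp: m_assoc)

end

end

section \<open>Coverings by images of finitely many cosets of cyclic subgroups\<close>

text \<open>A pair \<open>(s, a)\<close> in \<open>D\<close> stands for the coset \<open>s\<langle>a\<rangle>\<close>. The condition \<open>D_root\<close> expresses that this
  coset lies in a virtually cyclic group containing \<open>a\<close>; without it, \<open>s\<close> and \<open>a\<close> could generate a
  group of rank two.\<close>

locale covered_int_module = int_module +
  fixes D
  assumes D_finite: "finite D"
    and D_carrier: "(s, a) \<in> D \<Longrightarrow> s \<in> carrier A \<and> a \<in> carrier A"
    and D_cover: "y \<in> carrier A \<Longrightarrow> \<exists>s a j n. (s, a) \<in> D \<and> M j y = s \<otimes> a [^] (n::int)"
    and D_root: "(s, a) \<in> D \<Longrightarrow> \<exists>u>0. \<exists>m::int. s [^] (u::int) = a [^] m"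
begin

text \<open>A coset \<open>s\<langle>a\<rangle>\<close> meets \<open>V\<close> in finitely many classes modulo \<open>U\<close>: two elements of \<open>s\<langle>a\<rangle>\<close> in \<open>V\<close>
  differ by a power of \<open>a\<close> in \<open>V\<close>, so that some power of \<open>a\<close> lies in \<open>U\<close> and the exponents matter
  modulo a fixed number.\<close>

lemma finite_up_to_shift:
  assumes V: "submod V" and U: "submod U" and UV: "U \<subseteq> V"
    and tors: "\<And>v. v \<in> V \<Longrightarrow> \<exists>n>0. v [^] (n::int) \<in> U"
  obtains F where "finite F" "F \<subseteq> V" "\<And>v. v \<in> V \<Longrightarrow> \<exists>j. \<exists>f\<in>F. cong_mod U (M j v) f"
proof -
  have subV: "subgroup V A" and subU: "subgroup U A" using U V by (auto simp: submod_def)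
  have Vc: "V \<subseteq> carrier A" using subV subgroup.subset by blast
  have "\<exists>S. finite S \<and> S \<subseteq> V \<and> (\<forall>n::int. s \<otimes> a [^] n \<in> V \<longrightarrow> (\<exists>f\<in>S. cong_mod U (s \<otimes> a [^] n) f))"
    if "(s, a) \<in> D" for s a
  proof -
    have s: "s \<in> carrier A" and a: "a \<in> carrier A" using D_carrier that by auto
    show ?thesis
    proof (cases "\<exists>w>0::int. a [^] w \<in> U")
      case True
      then obtain w :: int where w: "w > 0" "a [^] w \<in> U" by blast
      let ?S = "(\<lambda>i. s \<otimes> a [^] i) ` {0..<w} \<inter> V"
      have "\<exists>f\<in>?S. cong_mod U (s \<otimes> a [^] n) f" if n: "s \<otimes> a [^] n \<in> V" for n :: int
      proof -
        have U': "(a [^] w) [^] (n div w) \<in> U"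
          using w(2) subU by (metis subgroup_int_pow_closed)
        have eq: "s \<otimes> a [^] n = (s \<otimes> a [^] (n mod w)) \<otimes> (a [^] w) [^] (n div w)"
          using a s int_pow_divmod[OF a, of n w] by (simp add: m_assoc)
        have "cong_mod U (s \<otimes> a [^] n) (s \<otimes> a [^] (n mod w))"
        proof -
          have "(s \<otimes> a [^] n) \<otimes> inv (s \<otimes> a [^] (n mod w)) = (a [^] w) [^] (n div w)"
            unfolding eq using a s by (simp add: mult_inv_cancel)
          then show ?thesis using U' by (simp add: cong_mod_def)
        qed
        moreover have "s \<otimes> a [^] (n mod w) \<in> V"
        proof -
          have eq': "s \<otimes> a [^] (n mod w) = (s \<otimes> a [^] n) \<otimes> inv ((a [^] w) [^] (n div w))"
            unfolding eq using a s by (metis int_pow_closed inv_solve_right m_closed)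
          show ?thesis unfolding eq' using subgroup.m_closed[OF subV n subgroup.m_inv_closed[OF subV]] U' UV
            by blast
        qed
        ultimately show ?thesis using w(1) by (intro bexI[of _ "s \<otimes> a [^] (n mod w)"]) auto
      qed
      then show ?thesis by (intro exI[of _ ?S]) auto
    next
      case False
      let ?S = "{s \<otimes> a [^] n | n::int. s \<otimes> a [^] n \<in> V}"
      have uniq: "n = n'" if n: "s \<otimes> a [^] n \<in> V" "s \<otimes> a [^] n' \<in> V" for n n' :: int
      proof -
        have *: "\<not> n < n'" if n: "s \<otimes> a [^] n \<in> V" "s \<otimes> a [^] n' \<in> V" for n n' :: int
        proof
          assume "n < n'"
          have "(s \<otimes> a [^] n') \<otimes> inv (s \<otimes> a [^] n) \<in> V"
            using n subV by (simp add: subgroup.m_closed subgroup.m_inv_closed)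
          moreover have "(s \<otimes> a [^] n') \<otimes> inv (s \<otimes> a [^] n) = a [^] (n' - n)"
            unfolding mult_inv_mult[OF s int_pow_closed[OF a] int_pow_closed[OF a]] using a by (simp add: int_pow_diff)
          ultimately obtain k :: int where "k > 0" "(a [^] (n' - n)) [^] k \<in> U" using tors by metis
          then have "a [^] ((n' - n) * k) \<in> U" "(n' - n) * k > 0" using a \<open>n < n'\<close> by (auto simp: int_pow_pow)
          then show False using False by blast
        qed
        show ?thesis using *[of n n'] *[of n' n] n by linarith
      qed
      have "?S \<subseteq> {s \<otimes> a [^] (THE n::int. s \<otimes> a [^] n \<in> V)}"
        using uniq by (auto) (metis (mono_tags, lifting) the_equality)
      then have "finite ?S" using finite_subset by blast
      moreover have "cong_mod U x x" if "x \<in> ?S" for x using that a s by (auto intro!: cong_mod_refl[OF U])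
      ultimately show ?thesis by (intro exI[of _ ?S]) blast
    qed
  qed
  then obtain S where S: "\<And>s a. (s, a) \<in> D \<Longrightarrow> finite (S s a) \<and> S s a \<subseteq> V \<and> 
      (\<forall>n::int. s \<otimes> a [^] n \<in> V \<longrightarrow> (\<exists>f\<in>S s a. cong_mod U (s \<otimes> a [^] n) f))" by metis
  let ?F = "\<Union>(s, a)\<in>D. S s a"
  have "\<exists>j. \<exists>f\<in>?F. cong_mod U (M j v) f" if "v \<in> V" for v
  proof -
    obtain s a j and n::int where *: "(s, a) \<in> D" "M j v = s \<otimes> a [^] n" using D_cover Vc \<open>v \<in> V\<close> by blast
    moreover have "M j v \<in> V" using V \<open>v \<in> V\<close> by (simp add: submod_def)
    ultimately obtain f where "f \<in> S s a" "cong_mod U (M j v) f" using S[OF *(1)] by auto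
    then show ?thesis using *(1) by (intro exI[of _ j] bexI[of _ f]) auto
  qed
  moreover have "finite ?F" "?F \<subseteq> V" using S D_finite by auto
  ultimately show ?thesis using that by blast
qed

end

context int_module begin

lemma finite_cosets_Suc:
  assumes U: "submod U" and Y: "subgroup Y A" "U \<subseteq> Y" and F: "finite F" "F \<subseteq> carrier A" "Y \<subseteq> F <#> U"
    and e: "e \<in> carrier A" "n > 0" "e [^] (n::int) \<in> U"
  shows "\<exists>F'. finite F' \<and> F' \<subseteq> carrier A \<and> {x \<otimes> e [^] k | x k::int. x \<in> Y} \<subseteq> F' <#> U"
proof -
  have subU: "subgroup U A" using U by (simp add: submod_def)
  let ?F = "(\<lambda>(f, i). f \<otimes> e [^] i) ` (F \<times> {0..<n})"
  have "x \<otimes> e [^] k \<in> ?F <#> U" if x: "x \<in> Y" for x and k :: int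
  proof -
    obtain f y where f: "f \<in> F" "y \<in> U" "x = f \<otimes> y" using x F by (auto simp: set_mult_def)
    have c: "f \<in> carrier A" "y \<in> carrier A" using f F subU subgroup.subset by blast+
    have "x \<otimes> e [^] k = (f \<otimes> e [^] (k mod n)) \<otimes> (y \<otimes> (e [^] n) [^] (k div n))"
      using c e(1) f int_pow_divmod[OF e(1), of k n] by (simp add: m_ac)
    moreover have "y \<otimes> (e [^] n) [^] (k div n) \<in> U"
      using f e subU by (metis subgroup_int_pow_closed subgroup.m_closed)
    moreover have "f \<otimes> e [^] (k mod n) \<in> ?F" using f e by force
    ultimately show ?thesis unfolding set_mult_def by blast
  qed
  moreover have "finite ?F" "?F \<subseteq> carrier A" using F e by auto
  ultimately show ?thesis by blast
qed

text \<open>The relation writes \<open>M t v\<close> in terms of earlier members of the sequence \<open>M i v\<close>. Hence \<open>U\<close>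
  together with a window of this sequence generates a subgroup that \<open>M 1\<close> maps into itself. As \<open>v\<close> is
  torsion modulo \<open>U\<close>, this subgroup has finite index over \<open>U\<close>, and the sequence must repeat.\<close>

lemma periodic_of_recurrence:
  assumes U: "submod U" and v: "v \<in> carrier A" and n: "n > 0" "v [^] (n::int) \<in> U"
    and t: "s1 < t" "s2 < t" "s3 < t"
    and rec: "cong_mod U (M t v) (M s1 v \<otimes> M s2 v \<otimes> inv (M s3 v))"
  shows "\<exists>k>0. cong_mod U (M k v) v"
proof -
  have subU: "subgroup U A" using U by (simp add: submod_def)
  define lo where "lo = min s1 (min s2 s3)"
  define e where "e i = M (lo + int i) v" for i
  have e: "e i \<in> carrier A" for i using v by (simp add: e_def)
  have en: "e i [^] n \<in> U" for i
    using U n(2) v unfolding e_def submod_def by (metis M_pow)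
  \<comment> \<open>\<open>Y i\<close> is generated by \<open>U\<close> and the first \<open>i\<close> members of the window, which starts at \<open>lo\<close>.\<close>
  define Y where "Y = rec_nat U (\<lambda>i Z. {x \<otimes> e i [^] k | x k::int. x \<in> Z})"
  have Y0: "Y 0 = U" and YS: "Y (Suc i) = {x \<otimes> e i [^] k | x k::int. x \<in> Y i}" for i
    by (auto simp: Y_def)
  have sub: "subgroup (Y i) A" for i
  proof (induction i)
    case 0 then show ?case using subU Y0 by simp
  next
    case (Suc i)
    interpret Y: subgroup "Y i" A by fact
    show ?case
    proof (rule subgroupI)
      show "Y (Suc i) \<subseteq> carrier A" using e by (auto simp: YS)
      have "\<one> \<otimes> e i [^] (0::int) \<in> Y (Suc i)" unfolding YS using Y.one_closed by blast
      then show "Y (Suc i) \<noteq> {}" by blast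
    next
      fix x assume "x \<in> Y (Suc i)"
      then obtain y and k::int where y: "y \<in> Y i" "x = y \<otimes> e i [^] k" by (auto simp: YS)
      have "inv x = inv y \<otimes> e i [^] (- k)" using y e by (simp add: inv_mult int_pow_neg)
      then show "inv x \<in> Y (Suc i)" unfolding YS using y(1) Y.m_inv_closed by blast
    next
      fix x x' assume "x \<in> Y (Suc i)" "x' \<in> Y (Suc i)"
      then obtain y y' and k k'::int where y: "y \<in> Y i" "x = y \<otimes> e i [^] k" "y' \<in> Y i" "x' = y' \<otimes> e i [^] k'" by (auto simp: YS)
      then have "x \<otimes> x' = (y \<otimes> y') \<otimes> e i [^] (k + k')" using e by (simp add: int_pow_mult m_ac)
      then show "x \<otimes> x' \<in> Y (Suc i)" unfolding YS using y Y.m_closed by blast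
    qed
  qed
  have inc: "Y i \<subseteq> Y (Suc i)" for i
  proof
    fix x assume "x \<in> Y i"
    moreover have "x \<otimes> e i [^] (0::int) = x" using subgroup.mem_carrier[OF sub \<open>x \<in> Y i\<close>] by simp
    ultimately show "x \<in> Y (Suc i)" unfolding YS by (metis (mono_tags, lifting) CollectI)
  qed
  have mono: "Y i \<subseteq> Y j" if "i \<le> j" for i j using lift_Suc_mono_le[of Y, OF inc that] .
  have UX: "U \<subseteq> Y i" for i using mono[of 0 i] Y0 by simp
  have eX: "e i \<in> Y (Suc i)" for i
  proof -
    have "e i = \<one> \<otimes> e i [^] (1::int)" using e by simp
    then show ?thesis unfolding YS using subgroup.one_closed[OF sub[of i]] by blast
  qed
  have fin: "\<exists>F. finite F \<and> F \<subseteq> carrier A \<and> Y i \<subseteq> F <#> U" for i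
  proof (induction i)
    case 0
    have "Y 0 \<subseteq> {\<one>} <#> U"
    unfolding Y0
    proof
      fix x assume "x \<in> U"
      moreover from this have "x = \<one> \<otimes> x" using subgroup.mem_carrier[OF subU] by simp
      ultimately show "x \<in> {\<one>} <#> U" unfolding set_mult_def by blast
    qed
    then show ?case by (intro exI[of _ "{\<one>}"]) auto
  next
    case (Suc i)
    then obtain F where F: "finite F" "F \<subseteq> carrier A" "Y i \<subseteq> F <#> U"
      by metis
    show ?case unfolding YS by (rule finite_cosets_Suc[OF U sub UX F e n(1) en])
  qed
  define d where "d = nat (t - lo)"
  have d: "int d = t - lo" using t by (simp add: d_def lo_def)
  have in_d: "e i \<in> Y d" if "i < d" for i using eX[of i] mono[of "Suc i" d] that by auto
  have ed: "e d \<in> Y d"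
  proof -
    have *: "M s v \<in> Y d" if "s \<in> {s1, s2, s3}" for s
    proof -
      have "nat (s - lo) < d" using that t d by (auto simp: lo_def)
      then have "e (nat (s - lo)) \<in> Y d" by (rule in_d)
      moreover have "lo + int (nat (s - lo)) = s" using that by (auto simp: lo_def)
      ultimately show ?thesis by (simp add: e_def)
    qed
    have "M s1 v \<otimes> M s2 v \<otimes> inv (M s3 v) \<in> Y d"
      using * sub by (simp add: subgroup.m_closed subgroup.m_inv_closed)
    then have "M t v \<in> Y d"
      using cong_mod_in[OF U _ _ rec sub UX] v by simp
    then show ?thesis using d by (simp add: e_def)
  qed
  have shift: "M 1 x \<in> Y d" if "x \<in> Y i" "i \<le> d" for x i
    using that
  proof (induction i arbitrary: x)
    case 0
    then show ?case using U UX Y0 by (auto simp: submod_def)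
  next
    case (Suc i)
    then obtain y and k::int where y: "y \<in> Y i" "x = y \<otimes> e i [^] k" by (auto simp: YS)
    have "M 1 (e i) = e (Suc i)" using M_add[OF v, of 1 "lo + int i"] by (simp add: e_def add_ac)
    moreover have "e (Suc i) \<in> Y d" using in_d[of "Suc i"] ed Suc.prems by (cases "Suc i = d") auto
    ultimately have "M 1 (e i [^] k) \<in> Y d" using e sub by (simp add: M_pow subgroup_int_pow_closed)
    moreover have "M 1 y \<in> Y d" using Suc y by simp
    moreover have "y \<in> carrier A" using subgroup.mem_carrier[OF sub y(1)] .
    ultimately show ?case using y e sub by (simp add: M_mult subgroup.m_closed)
  qed
  have all: "e i \<in> Y d" for i
  proof (induction i)
    case 0
    have "d > 0" using d t by (auto simp: lo_def)
    then show ?case by (rule in_d)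
  next
    case (Suc i)
    have "M 1 (e i) = e (Suc i)" using M_add[OF v, of 1 "lo + int i"] by (simp add: e_def add_ac)
    then show ?case using shift[OF Suc] by simp
  qed
  obtain F where F: "finite F" "F \<subseteq> carrier A" "Y d \<subseteq> F <#> U"
    using fin[of d] by metis
  have "\<exists>f\<in>F. cong_mod U (e i) f" for i
  proof -
    obtain f x where "f \<in> F" "x \<in> U" "e i = f \<otimes> x" using all[of i] F(3) unfolding set_mult_def by blast
    moreover from this have "e i \<otimes> inv f = x"
      using F(2) subgroup.mem_carrier[OF subU] by (auto simp: mult_inv_cancel subset_eq)
    ultimately show ?thesis by (intro bexI[of _ f]) (simp_all add: cong_mod_def)
  qed
  then obtain f where f: "\<And>i. f i \<in> F" "\<And>i. cong_mod U (e i) (f i)" by metis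
  have "\<not> inj f" using F(1) f(1) by (meson finite_subset finite_imageD image_subsetI infinite_UNIV_nat)
  then obtain i j where ij: "f i = f j" "i < j" by (metis injI linorder_neqE_nat)
  have fc: "f i \<in> carrier A" for i using f F by blast
  have "cong_mod U (e j) (e i)"
    using cong_mod_trans[OF U e fc e] f(2) cong_mod_sym[OF U e fc] ij(1) by metis
  moreover have "e j = M (lo + int i) (M (int j - int i) v)"
    using M_add[OF v, of "lo + int i" "int j - int i"] by (simp add: e_def)
  ultimately have "cong_mod U (M (int j - int i) v) v" using cong_mod_M_iff[OF U] v by (simp add: e_def)
  then show ?thesis using ij(2) by (intro exI[of _ "int j - int i"]) simp
qed

lemma cong_mod_period_mult:
  assumes U: "submod U" and v: "v \<in> carrier A" and k: "cong_mod U (M k v) v"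
  shows "cong_mod U (M (k * int n) v) v"
proof (induction n)
  case 0 then show ?case using v U by (simp add: M_0 cong_mod_refl)
next
  case (Suc n)
  have "M (k * int (Suc n)) v = M k (M (k * int n) v)"
    using M_add[OF v, of k "k * int n"] by (simp add: algebra_simps)
  moreover have "cong_mod U (M k (M (k * int n) v)) (M k v)" using Suc v U by (simp add: cong_mod_M_iff)
  ultimately show ?case using cong_mod_trans[OF U _ _ v _ k] v by simp
qed

end

context covered_int_module begin

text \<open>The central finiteness lemma. By \<open>finite_up_to_shift\<close>, among the elements \<open>v \<otimes> M (1 + m) v\<close> two
  with different \<open>m\<close> agree modulo \<open>U\<close> up to a power of \<open>M\<close>. In the resulting relation the largest
  exponent of \<open>M\<close> occurs just once, unless the relation is already a periodicity; so the relation is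
  a recurrence for the orbit of \<open>v\<close>. The period is uniform because every \<open>v\<close> has the period of
  one of finitely many representatives.\<close>

lemma bounded_period:
  assumes V: "submod V" and U: "submod U" and UV: "U \<subseteq> V"
    and tors: "\<And>v. v \<in> V \<Longrightarrow> \<exists>n>0. v [^] (n::int) \<in> U"
  obtains r :: nat where "r > 0" "\<And>v. v \<in> V \<Longrightarrow> cong_mod U (M (int r) v) v"
proof -
  obtain F where F: "finite F" "F \<subseteq> V" "\<And>v. v \<in> V \<Longrightarrow> \<exists>j. \<exists>f\<in>F. cong_mod U (M j v) f"
    using finite_up_to_shift[OF assms] by blast
  have subV: "subgroup V A" using V by (auto simp: submod_def)
  have Vc: "V \<subseteq> carrier A" using subV subgroup.subset by blast
  have per: "\<exists>k>0. cong_mod U (M k v) v" if v: "v \<in> V" for v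
  proof -
    have vc: "v \<in> carrier A" using v Vc by blast
    define b where "b m = v \<otimes> M (1 + int m) v" for m
    have bV: "b m \<in> V" for m using v V by (auto simp: b_def submod_def subgroup.m_closed)
    have bc: "b m \<in> carrier A" for m using bV Vc by blast
    obtain j f where jf: "\<And>m. f m \<in> F" "\<And>m. cong_mod U (M (j m) (b m)) (f m)"
      using F(3)[OF bV] by metis
    have "\<not> inj f" using F(1) jf(1) by (meson finite_subset finite_imageD image_subsetI infinite_UNIV_nat)
    then obtain x y where xy: "f x = f y" "x \<noteq> y" by (metis injI)
    have fc: "f m \<in> carrier A" for m using jf(1) F(2) Vc by blast
    define J where "J = j x - j y"
    have "cong_mod U (M (j x) (b x)) (M (j y) (b y))"
      using cong_mod_trans[OF U _ fc] jf(2) cong_mod_sym[OF U _ fc] xy(1) bc by (metis M_closed)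
    then have "cong_mod U (M (j y) (M J (b x))) (M (j y) (b y))"
      using M_add[OF bc[of x], of "j y" J] by (simp add: J_def)
    then have "cong_mod U (M J (b x)) (b y)" using cong_mod_M_iff[OF U] bc by simp
    then have rel: "cong_mod U (M J v \<otimes> M (J + (1 + int x)) v) (v \<otimes> M (1 + int y) v)"
      using vc by (simp add: b_def M_mult M_add)
    obtain n :: int where n: "n > 0" "v [^] n \<in> U" using tors v by blast
    consider "J + (1 + int x) = 1 + int y" | "J + (1 + int x) < 1 + int y" | "J + (1 + int x) > 1 + int y" by linarith
    then show ?thesis
    proof cases
      case 1
      have rel': "cong_mod U (M J v) v"
        using rel vc cong_mod_cancel[OF U, of "M J v" v "M (1 + int y) v"] unfolding 1 by simp
      then have rel'': "cong_mod U v (M (-J) v)"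
        using cong_mod_M[OF U _ _ rel', of "- J"] vc by simp
      have "J \<noteq> 0" using 1 xy by auto
      then consider "J > 0" | "-J > 0" by linarith
      then show ?thesis using rel' cong_mod_sym[OF U _ _ rel''] vc by (cases) (auto intro: exI[of _ J] exI[of _ "-J"])
    next
      case 2
      have "cong_mod U (M (1 + int y) v) (M J v \<otimes> M (J + (1 + int x)) v \<otimes> inv (M 0 v))"
        using cong_mod_mult[OF U _ _ _ _ cong_mod_sym[OF U _ _ rel] cong_mod_refl[OF U, of "inv v"]] vc
        by (simp add: M_0 mult_inv_cancel)
      then show ?thesis using 2 by (intro periodic_of_recurrence[OF U vc n]) auto
    next
      case 3
      have "cong_mod U (M (J + (1 + int x)) v) (M 0 v \<otimes> M (1 + int y) v \<otimes> inv (M J v))"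
        using cong_mod_mult[OF U _ _ _ _ rel cong_mod_refl[OF U, of "inv (M J v)"]] vc
        by (simp add: M_0 mult_inv_cancel)
      then show ?thesis using 3 by (intro periodic_of_recurrence[OF U vc n]) auto
    qed
  qed
  then have "\<forall>v\<in>V. \<exists>k>0. cong_mod U (M (int k) v) v" by (metis pos_int_cases)
  then obtain k where k: "\<And>v. v \<in> V \<Longrightarrow> k v > 0 \<and> cong_mod U (M (int (k v)) v) v" by metis
  define r where "r = prod k F"
  have "r > 0" unfolding r_def using k F(2) by (intro prod_pos) auto
  moreover have "cong_mod U (M (int r) v) v" if v: "v \<in> V" for v
  proof -
    have vc: "v \<in> carrier A" using v Vc by blast
    obtain j f where f: "f \<in> F" "cong_mod U (M j v) f" using F(3) v by blast
    have fc: "f \<in> carrier A" using f F(2) Vc by blast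
    have "k f dvd r" using f(1) F(1) by (simp add: r_def dvd_prodI)
    then obtain q where "r = k f * q" ..
    then have "cong_mod U (M (int r) f) f" using cong_mod_period_mult[OF U fc] k f F(2) by auto
    then have "cong_mod U (M (int r) (M j v)) (M j v)"
      using cong_mod_trans[OF U _ _ _ cong_mod_M[OF U _ _ f(2)]] cong_mod_trans[OF U] cong_mod_sym[OF U] f(2) vc fc
      by (meson M_closed)
    moreover have "M (int r) (M j v) = M j (M (int r) v)" using M_add[OF vc] by (metis add.commute)
    ultimately show ?thesis using cong_mod_M_iff[OF U] vc by simp
  qed
  ultimately show ?thesis using that by blast
qed

end

context int_module begin

section \<open>Norms and torsion\<close>

text \<open>This is the norm of the automorphism \<open>M L\<close>, the product of the first \<open>q\<close> members of an orbit; it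
  is the part in \<open>A\<close> of the \<open>q\<close>-th power of \<open>ac\<^sup>L\<close> when \<open>c\<close> induces \<open>M 1\<close> on \<open>A\<close>
  (\<open>pow_twisted\<close> below).\<close>

primrec shift_norm :: "nat \<Rightarrow> nat \<Rightarrow> 'a \<Rightarrow> 'a" where
  "shift_norm L 0 a = \<one>"
| "shift_norm L (Suc q) a = shift_norm L q a \<otimes> M (int (q * L)) a"

lemma shift_norm_closed [simp]: "a \<in> carrier A \<Longrightarrow> shift_norm L q a \<in> carrier A"
  by (induction q) auto

lemma shift_norm_add: "a \<in> carrier A \<Longrightarrow> shift_norm L (m + n) a = shift_norm L m a \<otimes> M (int (m * L)) (shift_norm L n a)"
proof (induction n)
  case (Suc n)
  have "M (int ((m + n) * L)) a = M (int (m * L)) (M (int (n * L)) a)"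
    using M_add[OF Suc.prems, of "int (m * L)" "int (n * L)"] by (simp add: distrib_right)
  then show ?case using Suc by (simp add: M_mult m_assoc)
qed simp

text \<open>If \<open>M\<close> has period \<open>r\<close> modulo \<open>U\<close>, so has \<open>M L\<close>, and the \<open>r * k\<close> factors of the norm fall into \<open>k\<close>
  equal blocks.\<close>

lemma cong_mod_shift_norm_mult:
  assumes U: "submod U" and r: "\<And>v. v \<in> carrier A \<Longrightarrow> cong_mod U (M (int r) v) v" and a: "a \<in> carrier A"
  shows "cong_mod U (shift_norm L (r * k) a) (shift_norm L r a [^] int k)"
proof (induction k)
  case 0 then show ?case using U by (simp add: cong_mod_refl)
next
  case (Suc k)
  let ?z = "shift_norm L r a"
  have z: "?z \<in> carrier A" using a by simp
  have "shift_norm L (r * Suc k) a = shift_norm L (r * k) a \<otimes> M (int (r * k * L)) ?z"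
    using shift_norm_add[OF a, of L "r * k" r] by (simp add: add.commute)
  moreover have "cong_mod U (M (int (r * k * L)) ?z) ?z"
    using cong_mod_period_mult[OF U z r[OF z], of "k * L"] by (simp add: mult.assoc)
  moreover have "?z [^] int (Suc k) = ?z [^] int k \<otimes> ?z"
    using int_pow_mult[OF z, of "int k" 1] z by (simp add: add.commute)
  ultimately show ?case using cong_mod_mult[OF U _ _ _ _ Suc] z a by simp
qed

lemma submod_carrier: "submod (carrier A)"
  by (simp add: submod_def subgroup_self)

lemma submod_one: "submod {\<one>}"
  by (simp add: submod_def triv_subgroup)

lemma cong_mod_one_iff: "x \<in> carrier A \<Longrightarrow> y \<in> carrier A \<Longrightarrow> cong_mod {\<one>} x y \<longleftrightarrow> x = y"
  unfolding cong_mod_def by (metis inv_closed inv_solve_right l_one one_closed r_inv singletonD singletonI)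

lemma submod_powers: "submod {x [^] (p::int) | x. x \<in> carrier A}"
  unfolding submod_def
proof (intro conjI allI ballI subgroupI)
  fix y assume "y \<in> {x [^] p | x. x \<in> carrier A}"
  then obtain x where x: "x \<in> carrier A" "y = x [^] p" by blast
  have "inv y = (inv x) [^] p" using x by (simp add: int_pow_inv)
  then show "inv y \<in> {x [^] p | x. x \<in> carrier A}" using x by blast
  fix y' assume "y' \<in> {x [^] p | x. x \<in> carrier A}"
  then obtain x' where x': "x' \<in> carrier A" "y' = x' [^] p" by blast
  have "y \<otimes> y' = (x \<otimes> x') [^] p" using x x' by (simp add: int_pow_distrib)
  then show "y \<otimes> y' \<in> {x [^] p | x. x \<in> carrier A}" using x x' by blast
next
  fix j y assume "y \<in> {x [^] p | x. x \<in> carrier A}"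
  then obtain x where x: "x \<in> carrier A" "y = x [^] p" by blast
  then have "M j y = M j x [^] p" by (simp add: M_pow)
  then show "M j y \<in> {x [^] p | x. x \<in> carrier A}" using x by blast
qed auto

definition torsion :: "'a set" where
  "torsion = {t \<in> carrier A. \<exists>n>0. t [^] (n::int) = \<one>}"

lemma submod_torsion: "submod torsion"
  unfolding submod_def
proof (intro conjI allI ballI subgroupI)
  have "\<one> \<in> torsion" by (auto simp: torsion_def intro: exI[of _ "1::int"])
  then show "torsion \<noteq> {}" by blast
  fix y assume "y \<in> torsion"
  then obtain n :: int where x: "y \<in> carrier A" "n > 0" "y [^] n = \<one>" by (auto simp: torsion_def)
  show "inv y \<in> torsion" using x by (auto simp: torsion_def int_pow_inv)
  fix y' assume "y' \<in> torsion"
  then obtain n' :: int where x': "y' \<in> carrier A" "n' > 0" "y' [^] n' = \<one>" by (auto simp: torsion_def)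
  have "(y \<otimes> y') [^] (n * n') = (y [^] n) [^] n' \<otimes> (y' [^] n') [^] n"
    using x(1) x'(1) by (simp add: int_pow_distrib int_pow_pow mult.commute)
  then have "(y \<otimes> y') [^] (n * n') = \<one>" using x x' by simp
  then show "y \<otimes> y' \<in> torsion" using x x' unfolding torsion_def by (auto intro!: exI[of _ "n * n'"])
next
  fix j y assume "y \<in> torsion"
  then show "M j y \<in> torsion" by (auto simp: torsion_def M_pow[symmetric])
qed (auto simp: torsion_def)

lemma iterate_proportion:
  assumes e: "e \<in> carrier A" and rel: "e [^] (\<alpha>::int) = M K e [^] (\<beta>::int)"
  shows "e [^] (\<alpha> ^ i) = M (K * int i) e [^] (\<beta> ^ i)"
proof (induction i)
  case 0 then show ?case using e by (simp add: M_0)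
next
  case (Suc i)
  have "e [^] (\<alpha> ^ Suc i) = (e [^] (\<alpha> ^ i)) [^] \<alpha>" using e by (simp add: int_pow_pow mult.commute)
  also have "\<dots> = M (K * int i) (e [^] \<alpha>) [^] (\<beta> ^ i)"
    unfolding Suc using e by (simp add: M_pow int_pow_pow mult.commute)
  also have "\<dots> = M (K * int i + K) e [^] (\<beta> ^ Suc i)"
    unfolding rel using e by (simp add: M_pow M_add int_pow_pow mult.commute)
  finally show ?case by (simp add: algebra_simps)
qed

lemma pow_inj_of_no_torsion:
  assumes "e \<in> carrier A" "e \<notin> torsion" "e [^] (m::int) = e [^] (n::int)"
  shows "m = n"
proof -
  have *: "\<not> m < n" if "e [^] m = e [^] n" for m n :: int
  proof
    assume "m < n"
    have "e [^] (n - m) = \<one>" using assms(1) that by (simp add: int_pow_diff)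
    then show False using \<open>m < n\<close> assms by (auto simp: torsion_def)
  qed
  show ?thesis using *[of m n] *[of n m] assms(3) by force
qed

text \<open>Over the rationals the relations would say that \<open>M K\<close> and \<open>M D\<close> act on the line of \<open>e\<close> as \<open>s / r\<close>
  and \<open>s / n\<close>. Comparing the powers \<open>M (K * \<bar>D\<bar>)\<close> and \<open>M (D * \<bar>K\<bar>)\<close>, which are equal or inverse to
  each other, gives an equation between integers in which \<open>n\<close> divides one side.\<close>

lemma proportional_divisor:
  assumes e: "e \<in> carrier A" "e \<notin> torsion" and K: "K \<noteq> 0" and p: "Factorial_Ring.prime p" "p dvd n"
    and rel1: "e [^] (s::int) = M K e [^] (r::int)" and rel2: "e [^] s = M D e [^] (n::int)"
  shows "p dvd s \<or> p dvd r"
proof -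
  define k d where "k = nat \<bar>K\<bar>" and "d = nat \<bar>D\<bar>"
  have k: "k > 0" using K by (simp add: k_def)
  define w where "w = M (K * int d) e"
  have w: "w \<in> carrier A" using e by (simp add: w_def)
  have r1: "e [^] (s ^ d) = w [^] (r ^ d)" using iterate_proportion[OF e(1) rel1] by (simp add: w_def)
  have r2: "e [^] (s ^ k) = M (D * int k) e [^] (n ^ k)" using iterate_proportion[OF e(1) rel2] .
  have pn: "p dvd n ^ k" using p k by (meson dvd_power dvd_trans)
  have "D * int k = K * int d \<or> D * int k = - (K * int d)"
    unfolding k_def d_def by (auto simp: abs_if)
  then show ?thesis
  proof
    assume "D * int k = K * int d"
    then have "e [^] (s ^ k) = w [^] (n ^ k)" using r2 by (simp add: w_def)
    then have "(e [^] (s ^ k)) [^] (r ^ d) = (w [^] (r ^ d)) [^] (n ^ k)"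
      using w by (simp add: int_pow_pow mult.commute)
    then have "e [^] (s ^ k * r ^ d) = e [^] (s ^ d * n ^ k)"
      unfolding r1[symmetric] using e by (simp add: int_pow_pow)
    then have "s ^ k * r ^ d = s ^ d * n ^ k" by (rule pow_inj_of_no_torsion[OF e])
    then have "p dvd s ^ k * r ^ d" using pn by simp
    then show ?thesis using p(1) by (metis prime_dvd_mult_iff prime_dvd_power)
  next
    assume "D * int k = - (K * int d)"
    then have "e [^] (s ^ k) = M (- (K * int d)) e [^] (n ^ k)" using r2 by simp
    then have "M (K * int d) (e [^] (s ^ k)) = e [^] (n ^ k)" using e by (simp add: M_pow[symmetric])
    then have "w [^] (s ^ k) = e [^] (n ^ k)" using e by (simp add: M_pow w_def)
    then have "(w [^] (r ^ d)) [^] (s ^ k) = (e [^] (n ^ k)) [^] (r ^ d)"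
      using w by (metis int_pow_pow mult.commute)
    then have "e [^] (s ^ d * s ^ k) = e [^] (n ^ k * r ^ d)"
      unfolding r1[symmetric] using e by (simp add: int_pow_pow)
    then have "s ^ d * s ^ k = n ^ k * r ^ d" by (rule pow_inj_of_no_torsion[OF e])
    then have "p dvd s ^ d * s ^ k" using pn by simp
    then show ?thesis using p(1) by (metis prime_dvd_mult_iff prime_dvd_power)
  qed
qed

end

lemma infinite_int_primes: "infinite {p::int. Factorial_Ring.prime p}"
proof
  assume fin: "finite {p::int. Factorial_Ring.prime p}"
  have "{p::nat. Factorial_Ring.prime p} \<subseteq> nat ` {p::int. Factorial_Ring.prime p}" by (auto simp: image_iff intro!: exI[of _ "int _"])
  then show False using finite_surj[OF fin] primes_infinite by blast
qed

lemma infinite_contains_nondivisor: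
  fixes s :: int
  assumes "infinite P" "s \<noteq> 0"
  obtains p where "p \<in> P" "\<not> p dvd s"
proof -
  have "finite {p. p dvd s}" using assms(2) by simp
  then show ?thesis using assms(1) that by (metis (mono_tags, lifting) finite_subset mem_Collect_eq subsetI)
qed

context covered_int_module begin

text \<open>For infinitely many primes \<open>p\<close> the same generator \<open>a\<close> occurs. If \<open>x\<close> had infinite order, then
  \<open>x\<close> would be, up to a power of \<open>M\<close>, both a fixed power \<open>s\<close> of an image \<open>e\<close> of \<open>a\<close> and a power of it
  with exponent divisible by \<open>p\<close>. A first prime not dividing \<open>s\<close> shows that a nontrivial power of \<open>M\<close>
  preserves the line of \<open>e\<close>; a second one then contradicts \<open>proportional_divisor\<close>.\<close>

lemma torsion_of_cyclic_divisors:
  assumes x: "x \<in> carrier A"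
    and div: "\<And>p::int. Factorial_Ring.prime p \<Longrightarrow> \<exists>s a j k. (s, a) \<in> D \<and> M j x = a [^] (p * k)"
  shows "x \<in> torsion"
proof (rule ccontr)
  assume nt: "x \<notin> torsion"
  obtain f j k where f: "\<And>p::int. Factorial_Ring.prime p \<Longrightarrow> f p \<in> D" and
    jk: "\<And>p::int. Factorial_Ring.prime p \<Longrightarrow> M (j p) x = snd (f p) [^] (p * k p)"
  proof -
    have "\<exists>d j k. Factorial_Ring.prime p \<longrightarrow> d \<in> D \<and> M j x = snd d [^] (p * k)" for p :: int
    proof (cases "Factorial_Ring.prime p")
      case True
      then obtain s a j k where "(s, a) \<in> D" "M j x = a [^] (p * k)" using div by blast
      then have "(s, a) \<in> D \<and> M j x = snd (s, a) [^] (p * k)" by simp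
      then show ?thesis by blast
    qed simp
    then show ?thesis using that by metis
  qed
  have "\<exists>d\<in>D. infinite {p. p \<in> {p::int. Factorial_Ring.prime p} \<and> f p = d}"
    using D_finite f infinite_int_primes pigeonhole_infinite_rel[of "{p::int. Factorial_Ring.prime p}" D "\<lambda>p d. f p = d"] by auto
  then obtain s0 a where sa: "(s0, a) \<in> D" and inf: "infinite {p::int. Factorial_Ring.prime p \<and> f p = (s0, a)}" by auto
  define P where "P = {p::int. Factorial_Ring.prime p \<and> f p = (s0, a)}"
  have a: "a \<in> carrier A" using D_carrier[OF sa] by simp
  have P: "infinite P" "\<And>p. p \<in> P \<Longrightarrow> Factorial_Ring.prime p" "\<And>p. p \<in> P \<Longrightarrow> M (j p) x = a [^] (p * k p)"
    using inf jk by (auto simp: P_def)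
  then obtain p0 where p0: "p0 \<in> P" by (metis ex_in_conv finite.emptyI)
  define e where "e = M (- j p0) a"
  have e: "e \<in> carrier A" using a by (simp add: e_def)
  define s where "s = p0 * k p0"
  have xM: "x = M (- j p) a [^] (p * k p)" if "p \<in> P" for p
    using arg_cong[OF P(3)[OF that], of "M (- j p)"] x a by (simp add: M_pow)
  have xe: "x = e [^] s" using xM[OF p0] by (simp add: e_def s_def)
  have rel: "e [^] s = M (j p0 - j p) e [^] (p * k p)" if "p \<in> P" for p
  proof -
    have "M (- j p) a = M (j p0 - j p) e"
      using M_add[OF a, of "j p0 - j p" "- j p0"] by (simp add: e_def)
    then show ?thesis using xM[OF that] xe by simp
  qed
  have ent: "e \<notin> torsion" using nt xe submod_torsion unfolding submod_def by (metis subgroup_int_pow_closed)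
  have x1: "x \<noteq> \<one>" using nt submod_torsion by (metis submod_def subgroup.one_closed)
  have s: "s \<noteq> 0" using xe x1 by auto
  obtain p1 where p1: "p1 \<in> P" "\<not> p1 dvd s" using infinite_contains_nondivisor[OF P(1) s] by blast
  define K r where "K = j p0 - j p1" and "r = p1 * k p1"
  have rel1: "e [^] s = M K e [^] r" using rel[OF p1(1)] by (simp add: K_def r_def)
  have K: "K \<noteq> 0"
  proof
    assume "K = 0"
    then have "e [^] s = e [^] r" using rel1 e by (simp add: M_0)
    then have "s = r" by (rule pow_inj_of_no_torsion[OF e ent])
    then show False using p1(2) by (simp add: r_def)
  qed
  have r: "r \<noteq> 0" using rel1 xe x1 by auto
  obtain p where p: "p \<in> P" "\<not> p dvd s * r" using infinite_contains_nondivisor[OF P(1), of "s * r"] s r by auto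
  have "p dvd s \<or> p dvd r"
    using proportional_divisor[OF e ent K P(2)[OF p(1)] _ rel1 rel[OF p(1)]] by simp
  then show False using p(2) by auto
qed

text \<open>The torsion subgroup has finitely many elements up to \<open>M\<close>, and \<open>M\<close> preserves orders.\<close>

lemma torsion_exponent:
  obtains \<tau> :: int where "\<tau> > 0" "\<And>t. t \<in> torsion \<Longrightarrow> t [^] \<tau> = \<one>"
proof -
  have tc: "t \<in> carrier A" if "t \<in> torsion" for t using that by (simp add: torsion_def)
  have "{\<one>} \<subseteq> torsion" using subgroup.one_closed[of torsion A] submod_torsion by (simp add: submod_def)
  moreover have "\<exists>n>0. v [^] (n::int) \<in> {\<one>}" if "v \<in> torsion" for v using that by (auto simp: torsion_def)
  ultimately obtain F where F: "finite F" "F \<subseteq> torsion" "\<And>v. v \<in> torsion \<Longrightarrow> \<exists>j. \<exists>f\<in>F. cong_mod {\<one>} (M j v) f"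
    using finite_up_to_shift[OF submod_torsion submod_one] by metis
  obtain n :: "'a \<Rightarrow> int" where n: "\<And>t. t \<in> torsion \<Longrightarrow> n t > 0 \<and> t [^] n t = \<one>"
  proof -
    have "\<forall>t. \<exists>n. t \<in> torsion \<longrightarrow> n > 0 \<and> t [^] (n::int) = \<one>" by (auto simp: torsion_def)
    then show ?thesis using that by metis
  qed
  define \<tau> where "\<tau> = prod n F"
  have "\<tau> > 0" unfolding \<tau>_def using n F(2) by (intro prod_pos) auto
  moreover have "t [^] \<tau> = \<one>" if t: "t \<in> torsion" for t
  proof -
    obtain j f where f: "f \<in> F" "cong_mod {\<one>} (M j t) f" using F(3)[OF t] by blast
    have ft: "f \<in> torsion" using f(1) F(2) by blast
    have jt: "M j t = f" using f(2) cong_mod_one_iff tc t ft by simp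
    have "n f dvd \<tau>" using f(1) F(1) by (simp add: \<tau>_def dvd_prodI)
    then obtain q where "\<tau> = n f * q" ..
    then have "f [^] \<tau> = (f [^] n f) [^] q" using tc[OF ft] by (simp add: int_pow_pow)
    then have "f [^] \<tau> = \<one>" using n[OF ft] by simp
    then have "M j (t [^] \<tau>) = \<one>" using M_pow[OF tc[OF t]] jt by simp
    then show ?thesis by (metis M_minus M_one int_pow_closed t tc)
  qed
  ultimately show ?thesis using that by blast
qed

lemma common_root_exponent:
  obtains u :: int where "u > 0" "\<And>y. y \<in> carrier A \<Longrightarrow> \<exists>s a j k. (s, a) \<in> D \<and> M j y [^] u = a [^] (k::int)"
proof -
  obtain w :: "'a \<times> 'a \<Rightarrow> int" where w: "\<And>d. d \<in> D \<Longrightarrow> w d > 0 \<and> (\<exists>m::int. fst d [^] w d = snd d [^] m)"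
  proof -
    have "\<exists>w. d \<in> D \<longrightarrow> w > 0 \<and> (\<exists>m::int. fst d [^] (w::int) = snd d [^] m)" for d
      using D_root[of "fst d" "snd d"] by auto
    then show ?thesis using that by metis
  qed
  define u where "u = prod w D"
  have "u > 0" unfolding u_def using w by (intro prod_pos) auto
  moreover have "\<exists>s a j k. (s, a) \<in> D \<and> M j y [^] u = a [^] (k::int)" if y: "y \<in> carrier A" for y
  proof -
    obtain s a j and n::int where *: "(s, a) \<in> D" "M j y = s \<otimes> a [^] n" using D_cover[OF y] by blast
    have c: "s \<in> carrier A" "a \<in> carrier A" using D_carrier * by auto
    obtain m :: int where m: "s [^] w (s, a) = a [^] m" using w[OF *(1)] by auto
    have "w (s, a) dvd u" using *(1) D_finite by (simp add: u_def dvd_prodI)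
    then obtain q where q: "u = w (s, a) * q" ..
    have "s [^] u = (s [^] w (s, a)) [^] q" unfolding q using c by (simp add: int_pow_pow)
    also have "\<dots> = a [^] (m * q)" unfolding m using c by (simp add: int_pow_pow)
    finally have "M j y [^] u = a [^] (m * q + n * u)"
      using c by (simp add: *(2) int_pow_distrib int_pow_pow int_pow_mult)
    then show ?thesis using *(1) by blast
  qed
  ultimately show ?thesis using that by blast
qed

text \<open>Taking \<open>q = r * p\<close> with \<open>r\<close> a period of \<open>M\<close> modulo \<open>p\<close>-th powers makes every norm a \<open>p\<close>-th power.
  So every \<open>x\<close> is a \<open>p\<close>-th power modulo torsion; raising it to \<open>\<tau> * u\<close>, where \<open>\<tau>\<close> kills
  the torsion and \<open>u\<close> moves cosets \<open>s\<langle>a\<rangle>\<close> into \<open>\<langle>a\<rangle>\<close>, leads to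
  \<open>torsion_of_cyclic_divisors\<close>.\<close>

theorem torsion_of_norms_onto:
  assumes onto: "\<And>b q. b \<in> carrier A \<Longrightarrow> q > 0 \<Longrightarrow> \<exists>t\<in>torsion. \<exists>a\<in>carrier A. b = t \<otimes> shift_norm L q a"
  shows "carrier A = torsion"
proof
  show "torsion \<subseteq> carrier A" by (auto simp: torsion_def)
  have divisible: "\<exists>t\<in>torsion. \<exists>y\<in>carrier A. b = t \<otimes> y [^] p" if b: "b \<in> carrier A" and p: "p > 0" for b and p :: int
  proof -
    let ?U = "{x [^] p | x. x \<in> carrier A}"
    have "?U \<subseteq> carrier A" by auto
    moreover have "\<exists>n>0. v [^] (n::int) \<in> ?U" if "v \<in> carrier A" for v using that p by blast
    ultimately obtain r :: nat where r: "r > 0" "\<And>v. v \<in> carrier A \<Longrightarrow> cong_mod ?U (M (int r) v) v"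
      using bounded_period[OF submod_carrier submod_powers] by blast
    obtain t a where ta: "t \<in> torsion" "a \<in> carrier A" "b = t \<otimes> shift_norm L (r * nat p) a"
      using onto[OF b, of "r * nat p"] r(1) p by auto
    have sub: "subgroup ?U A" using submod_powers by (simp add: submod_def)
    have c: "shift_norm L (r * nat p) a \<in> carrier A" "shift_norm L r a [^] p \<in> carrier A" using ta(2) by simp_all
    have "cong_mod ?U (shift_norm L (r * nat p) a) (shift_norm L r a [^] p)"
      using cong_mod_shift_norm_mult[OF submod_powers r(2) ta(2), where L = L and k = "nat p"] p by simp
    moreover have "shift_norm L r a [^] p \<in> ?U" by (rule CollectI) (use ta(2) in auto)
    ultimately have "shift_norm L (r * nat p) a \<in> ?U"
      using cong_mod_in[OF submod_powers c _ sub order_refl] by blast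
    then obtain y where "y \<in> carrier A" "shift_norm L (r * nat p) a = y [^] p" by auto
    then show ?thesis using ta by auto
  qed
  show "carrier A \<subseteq> torsion"
  proof
    fix x assume x: "x \<in> carrier A"
    obtain \<tau> :: int where \<tau>: "\<tau> > 0" "\<And>t. t \<in> torsion \<Longrightarrow> t [^] \<tau> = \<one>" using torsion_exponent by blast
    obtain u :: int where u: "u > 0" "\<And>y. y \<in> carrier A \<Longrightarrow> \<exists>s a j k. (s, a) \<in> D \<and> M j y [^] u = a [^] (k::int)"
      using common_root_exponent by blast
    have "x [^] (\<tau> * u) \<in> torsion"
    proof (rule torsion_of_cyclic_divisors)
      show "x [^] (\<tau> * u) \<in> carrier A" using x by simp
      fix p :: int assume p: "Factorial_Ring.prime p"
      then have "p > 0" by (simp add: prime_gt_0_int)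
      then obtain t y where ty: "t \<in> torsion" "y \<in> carrier A" "x = t \<otimes> y [^] p" using divisible[OF x] by blast
      have t: "t \<in> carrier A" using ty(1) by (simp add: torsion_def)
      obtain s a j and k::int where d: "(s, a) \<in> D" "M j y [^] u = a [^] k" using u(2)[OF ty(2)] by blast
      have a: "a \<in> carrier A" using D_carrier d by auto
      have "x [^] (\<tau> * u) = (t [^] \<tau>) [^] u \<otimes> (y [^] u) [^] (p * \<tau>)"
        unfolding ty(3) using t ty(2) by (simp add: int_pow_distrib int_pow_pow mult_ac)
      then have "x [^] (\<tau> * u) = (y [^] u) [^] (p * \<tau>)" using \<tau>(2)[OF ty(1)] ty(2) by simp
      then have "M j (x [^] (\<tau> * u)) = (M j y [^] u) [^] (p * \<tau>)" using ty(2) by (simp add: M_pow)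
      then have "M j (x [^] (\<tau> * u)) = a [^] (k * (p * \<tau>))"
        unfolding d(2) using a by (simp add: int_pow_pow)
      then have "M j (x [^] (\<tau> * u)) = a [^] (p * (k * \<tau>))" by (simp add: mult_ac)
      then show "\<exists>s a j k. (s, a) \<in> D \<and> M j (x [^] (\<tau> * u)) = a [^] (p * k)" using d(1) by blast
    qed
    then obtain n :: int where "n > 0" "(x [^] (\<tau> * u)) [^] n = \<one>" by (auto simp: torsion_def)
    then have "x [^] (\<tau> * u * n) = \<one>" "\<tau> * u * n > 0" using x \<tau>(1) u(1) by (auto simp: int_pow_pow)
    then show "x \<in> torsion" using x unfolding torsion_def by blast
  qed
qed

theorem finite_of_torsion:
  assumes tors: "carrier A = torsion"
  shows "finite (carrier A)"
proof -
  have *: "\<exists>n>0. v [^] (n::int) \<in> {\<one>}" if "v \<in> carrier A" for v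
    using that unfolding tors by (auto simp: torsion_def)
  have o: "{\<one>} \<subseteq> carrier A" by simp
  obtain F where F: "finite F" "F \<subseteq> carrier A" "\<And>v. v \<in> carrier A \<Longrightarrow> \<exists>j. \<exists>f\<in>F. cong_mod {\<one>} (M j v) f"
    using finite_up_to_shift[OF submod_carrier submod_one o *] by blast
  obtain r :: nat where r: "r > 0" "\<And>v. v \<in> carrier A \<Longrightarrow> cong_mod {\<one>} (M (int r) v) v"
    using bounded_period[OF submod_carrier submod_one o *] by blast
  have Mr: "M (int r * int n) v = v" if v: "v \<in> carrier A" for v n
    using cong_mod_period_mult[OF submod_one v r(2)[OF v], of n] cong_mod_one_iff v by simp
  have "carrier A \<subseteq> (\<lambda>(i, f). M i f) ` ({0..<int r} \<times> F)"
  proof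
    fix v assume v: "v \<in> carrier A"
    obtain j f where f: "f \<in> F" "cong_mod {\<one>} (M j v) f" using F(3)[OF v] by blast
    have fc: "f \<in> carrier A" using f F by blast
    have "M j v = f" using f(2) cong_mod_one_iff v fc by simp
    then have vf: "v = M (- j) f" using v by auto
    have "M (- j) f = M ((- j) mod int r) f"
    proof -
      have per: "M (int r * q) f = f" for q
      proof (cases "q \<ge> 0")
        case True then show ?thesis using Mr[OF fc, of "nat q"] by simp
      next
        case False
        then have "M (- (int r * q)) f = f" using Mr[OF fc, of "nat (- q)"] by simp
        then show ?thesis using M_minus'[OF fc, of "int r * q"] by simp
      qed
      have "- j = (- j) mod int r + int r * ((- j) div int r)" by simp
      then have "M (- j) f = M ((- j) mod int r) (M (int r * ((- j) div int r)) f)" using M_add[OF fc] by metis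
      then show ?thesis using per by simp
    qed
    then show "v \<in> (\<lambda>(i, f). M i f) ` ({0..<int r} \<times> F)" using f(1) r(1) vf
      by (intro image_eqI[of _ _ "((- j) mod int r, f)"]) auto
  qed
  then show ?thesis using F(1) finite_subset by blast
qed

end

section \<open>Virtually cyclic subgroups as finite unions of cosets\<close>

text \<open>For a subgroup \<open>H\<close> this is virtual cyclicity. Taking \<open>R\<close> in \<open>G\<close> and forgetting that \<open>d\<close> generates a
  subgroup of finite index makes the condition easy to transport along homomorphisms.\<close>

definition almost_cyclic :: "('a, 'b) monoid_scheme \<Rightarrow> 'a set \<Rightarrow> bool" where
  "almost_cyclic G H \<longleftrightarrow> (\<exists>d\<in>H. \<exists>R. finite R \<and> R \<subseteq> carrier G \<and>
     (\<forall>h\<in>H. \<exists>r\<in>R. \<exists>n::int. h = r \<otimes>\<^bsub>G\<^esub> d [^]\<^bsub>G\<^esub> n))"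

text \<open>For a normal subgroup \<open>N\<close> this says that \<open>\<langle>c\<rangle>N\<close> has finite index in \<open>G\<close>, equivalently that \<open>G/N\<close>
  is virtually cyclic, with \<open>c\<close> as a witness.\<close>

definition cofinite_mod :: "('a, 'b) monoid_scheme \<Rightarrow> 'a \<Rightarrow> 'a set \<Rightarrow> bool" where
  "cofinite_mod G c N \<longleftrightarrow> c \<in> carrier G \<and> (\<exists>R. finite R \<and> R \<subseteq> carrier G \<and>
     (\<forall>g\<in>carrier G. \<exists>r\<in>R. \<exists>n::int. \<exists>a\<in>N. g = r \<otimes>\<^bsub>G\<^esub> (c [^]\<^bsub>G\<^esub> n \<otimes>\<^bsub>G\<^esub> a)))"

definition conj_covered :: "('a, 'b) monoid_scheme \<Rightarrow> bool" where
  "conj_covered G \<longleftrightarrow> (\<exists>Hs. finite Hs \<and> (\<forall>H\<in>Hs. subgroup H G \<and> almost_cyclic G H) \<and>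
     (\<forall>g\<in>carrier G. \<exists>x\<in>carrier G. \<exists>H\<in>Hs. x \<otimes>\<^bsub>G\<^esub> g \<otimes>\<^bsub>G\<^esub> inv\<^bsub>G\<^esub> x \<in> H))"

context group begin

text \<open>Two powers of \<open>h\<close> lie in the same coset of \<open>\<langle>d\<rangle>\<close>.\<close>

lemma power_in_cyclic:
  assumes H: "subgroup H G" and d: "d \<in> H" and R: "finite R" "R \<subseteq> carrier G"
    and cov: "\<And>h. h \<in> H \<Longrightarrow> \<exists>r\<in>R. \<exists>n::int. h = r \<otimes> d [^] n" and h: "h \<in> H"
  obtains u m :: int where "u > 0" "h [^] u = d [^] m"
proof -
  have dc: "d \<in> carrier G" and hc: "h \<in> carrier G" using H d h subgroup.mem_carrier by metis+
  have "h [^] k \<in> H" for k :: nat using H h subgroup_int_pow_closed[of H h "int k"] by (simp add: int_pow_int)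
  then have "\<exists>r n. r \<in> R \<and> h [^] k = r \<otimes> d [^] (n::int)" for k :: nat using cov by blast
  then obtain r and n :: "nat \<Rightarrow> int" where rn: "\<And>k. r k \<in> R" "\<And>k::nat. h [^] k = r k \<otimes> d [^] n k" by metis
  have "\<not> inj r" using R(1) rn(1) by (meson finite_subset finite_imageD image_subsetI infinite_UNIV_nat)
  then obtain i j where ij: "r i = r j" "i < j" by (metis injI linorder_neqE_nat)
  have rc: "r i \<in> carrier G" using rn(1) R(2) by blast
  have "inv (h [^] i) \<otimes> h [^] j = d [^] (n j - n i)"
    using rc dc ij(1) unfolding rn(2) by (simp add: inv_mult_mult int_pow_diff_left)
  moreover have "inv (h [^] i) \<otimes> h [^] j = h [^] (int j - int i)"
    using hc by (simp add: int_pow_int[symmetric] int_pow_neg[symmetric] int_pow_mult[symmetric])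
  ultimately show ?thesis using that[of "int j - int i" "n j - n i"] ij(2) by simp
qed

text \<open>The subgroup \<open>B\<close> is covered by cosets of \<open>\<langle>d\<^sup>w\<rangle>\<close> if some \<open>d\<^sup>w\<close>, \<open>w > 0\<close>, lies in \<open>B\<close>. Otherwise \<open>B\<close>
  meets every coset of \<open>\<langle>d\<rangle>\<close> in at most one element, so it is finite.\<close>

lemma subgroup_of_almost_cyclic:
  assumes H: "subgroup H G" "almost_cyclic G H" and B: "subgroup B G" "B \<subseteq> H"
  obtains D where "finite D" "D \<subseteq> B \<times> B" "\<And>y. y \<in> B \<Longrightarrow> \<exists>s a. \<exists>n::int. (s, a) \<in> D \<and> y = s \<otimes> a [^] n"
    "\<And>s a. (s, a) \<in> D \<Longrightarrow> \<exists>u>0. \<exists>m::int. s [^] (u::int) = a [^] m"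
proof -
  obtain d R where d: "d \<in> H" and R: "finite R" "R \<subseteq> carrier G"
    and cov: "\<And>h. h \<in> H \<Longrightarrow> \<exists>r\<in>R. \<exists>n::int. h = r \<otimes> d [^] n"
    using H(2) unfolding almost_cyclic_def by auto
  have dc: "d \<in> carrier G" using subgroup.mem_carrier[OF H(1) d] .
  have Bc: "y \<in> carrier G" if "y \<in> B" for y using subgroup.mem_carrier[OF B(1) that] .
  have one: "\<one> \<in> B" using B(1) subgroup.one_closed by blast
  have root: "\<exists>u>0. \<exists>m::int. y [^] (u::int) = d [^] m" if y: "y \<in> B" for y
  proof -
    obtain u m :: int where "u > 0" "y [^] u = d [^] m"
      using power_in_cyclic[OF H(1) d R cov subsetD[OF B(2) y]] by blast
    then show ?thesis by blast
  qed
  show ?thesis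
  proof (cases "\<exists>w>0::int. d [^] w \<in> B")
    case True
    then obtain w :: int where w: "w > 0" "d [^] w \<in> B" by blast
    let ?D = "((\<lambda>(r, i). (r \<otimes> d [^] i, d [^] w)) ` (R \<times> {0..<w})) \<inter> B \<times> B"
    show ?thesis
    proof
      show "finite ?D" using R(1) by simp
      show "?D \<subseteq> B \<times> B" by blast
    next
      fix y assume y: "y \<in> B"
      obtain r and n :: int where rn: "r \<in> R" "y = r \<otimes> d [^] n" using cov y B(2) by blast
      have rc: "r \<in> carrier G" using rn(1) R(2) by blast
      have wq: "(d [^] w) [^] (n div w) \<in> B" using B(1) w(2) by (rule subgroup_int_pow_closed)
      have e: "y = (r \<otimes> d [^] (n mod w)) \<otimes> (d [^] w) [^] (n div w)"
        using rc dc int_pow_divmod[OF dc, of n w] by (simp add: rn(2) m_assoc)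
      have "r \<otimes> d [^] (n mod w) = y \<otimes> inv ((d [^] w) [^] (n div w))"
        unfolding e using rc dc by (simp add: m_assoc)
      then have "r \<otimes> d [^] (n mod w) \<in> B"
        using subgroup.m_closed[OF B(1) y subgroup.m_inv_closed[OF B(1) wq]] by simp
      then have "(r \<otimes> d [^] (n mod w), d [^] w) \<in> ?D"
        using w rn(1) by (auto intro!: image_eqI[of _ _ "(r, n mod w)"])
      then show "\<exists>s a. \<exists>n::int. (s, a) \<in> ?D \<and> y = s \<otimes> a [^] n" using e by blast
    next
      fix s a assume "(s, a) \<in> ?D"
      then have s: "s \<in> B" and a: "a = d [^] w" by auto
      obtain u m :: int where um: "u > 0" "s [^] u = d [^] m" using root[OF s] by blast
      have "s [^] (u * w) = a [^] m" unfolding a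
        using arg_cong[OF um(2), of "\<lambda>x. x [^] w"] Bc[OF s] dc by (simp add: int_pow_pow mult.commute)
      then show "\<exists>u>0. \<exists>m::int. s [^] (u::int) = a [^] m" using um(1) w(1) by (intro exI[of _ "u * w"]) auto
    qed
  next
    case False
    have no: "n = 0" if "d [^] n \<in> B" for n :: int
    proof -
      have "d [^] (- n) \<in> B" using subgroup.m_inv_closed[OF B(1) that] dc by (simp add: int_pow_neg)
      then have "\<not> n > 0" "\<not> - n > 0" using False that by blast+
      then show ?thesis by simp
    qed
    obtain f where f: "\<And>y. y \<in> B \<Longrightarrow> f y \<in> R \<and> (\<exists>n::int. y = f y \<otimes> d [^] n)"
      using cov B(2) by (metis subsetD)
    have "inj_on f B"
    proof (rule inj_onI)
      fix x y assume xy: "x \<in> B" "y \<in> B" "f x = f y"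
      obtain m n :: int where mn: "x = f x \<otimes> d [^] m" "y = f x \<otimes> d [^] n" using f xy by metis
      have fc: "f x \<in> carrier G" using f xy(1) R(2) by blast
      have "inv x \<otimes> y = inv (f x \<otimes> d [^] m) \<otimes> (f x \<otimes> d [^] n)" using mn by simp
      also have "\<dots> = d [^] (n - m)" using fc dc
        by (simp add: inv_mult_mult int_pow_diff_left)
      finally have "d [^] (n - m) \<in> B"
        using subgroup.m_closed[OF B(1) subgroup.m_inv_closed[OF B(1) xy(1)] xy(2)] by simp
      then have "n = m" using no[of "n - m"] by simp
      then show "x = y" using mn by simp
    qed
    then have "finite B" using f R(1) by (meson finite_imageD finite_subset image_subsetI)
    show ?thesis
    proof
      show "finite (B \<times> {\<one>})" using \<open>finite B\<close> by simp
      show "B \<times> {\<one>} \<subseteq> B \<times> B" using one by auto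
    next
      fix y assume y: "y \<in> B"
      then have "(y, \<one>) \<in> B \<times> {\<one>}" "y = y \<otimes> \<one> [^] (0::int)" using Bc by auto
      then show "\<exists>s a. \<exists>n::int. (s, a) \<in> B \<times> {\<one>} \<and> y = s \<otimes> a [^] n" by blast
    next
      fix s a assume "(s, a) \<in> B \<times> {\<one>}"
      then have s: "s \<in> B" "a = \<one>" by auto
      obtain u m :: int where um: "u > 0" "s [^] u = d [^] m" using root[OF s(1)] by blast
      have "s [^] u \<in> B" using B(1) s(1) by (rule subgroup_int_pow_closed)
      then have "m = 0" using no um by simp
      then show "\<exists>u>0. \<exists>m::int. s [^] (u::int) = a [^] m" using um s(2) by (intro exI[of _ u]) auto
    qed
  qed
qed

lemma almost_cyclic_conj:
  assumes H: "subgroup H G" "almost_cyclic G H" and x: "x \<in> carrier G"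
  shows "subgroup ((\<lambda>h. x \<otimes> h \<otimes> inv x) ` H) G \<and> almost_cyclic G ((\<lambda>h. x \<otimes> h \<otimes> inv x) ` H)"
proof -
  let ?f = "\<lambda>h. x \<otimes> h \<otimes> inv x"
  have hom: "group_hom G G ?f"
    using x by (auto simp: group_hom_def group_hom_axioms_def hom_def m_assoc)
       (simp add: m_assoc[symmetric])
  interpret f: group_hom G G ?f by (rule hom)
  obtain d R where d: "d \<in> H" and R: "finite R" "R \<subseteq> carrier G"
    and cov: "\<And>h. h \<in> H \<Longrightarrow> \<exists>r\<in>R. \<exists>n::int. h = r \<otimes> d [^] n"
    using H(2) unfolding almost_cyclic_def by auto
  have dc: "d \<in> carrier G" using subgroup.mem_carrier[OF H(1) d] .
  have "\<exists>r\<in>?f ` R. \<exists>n::int. ?f h = r \<otimes> ?f d [^] n" if h: "h \<in> H" for h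
  proof -
    obtain r and n :: int where rn: "r \<in> R" "h = r \<otimes> d [^] n" using cov[OF h] by blast
    have "?f h = ?f r \<otimes> ?f d [^] n" unfolding rn(2)
      using f.hom_mult[of r "d [^] n"] f.hom_int_pow[OF dc, of n] rn(1) R(2) dc by auto
    then show ?thesis using rn(1) by blast
  qed
  then have "almost_cyclic G (?f ` H)" unfolding almost_cyclic_def
    using d R x by (intro bexI[of _ "?f d"] exI[of _ "?f ` R"]) auto
  then show ?thesis using f.subgroup_img_is_subgroup[OF H(1)] by simp
qed

end

text \<open>Let \<open>x\<close> have infinite order. For every \<open>b\<close> two of the elements \<open>b \<otimes> x [^] m\<close> lie in one of the
  given cosets \<open>s\<langle>a\<rangle>\<close>, so that \<open>\<langle>a\<rangle>\<close> and \<open>\<langle>x\<rangle>\<close> are commensurable. Hence the cosets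
  whose \<open>a\<close> is commensurable with \<open>x\<close>, each of them inside finitely many cosets of \<open>\<langle>x\<rangle>\<close>,
  give the whole group after multiplication with \<open>\<langle>x\<rangle>\<close>. If there is no such \<open>x\<close>, the group is
  finite.\<close>

lemma (in comm_group) cyclic_cosets_cover:
  assumes D: "finite D" "D \<subseteq> carrier G \<times> carrier G"
    and cov: "\<And>y. y \<in> carrier G \<Longrightarrow> \<exists>s a. \<exists>n::int. (s, a) \<in> D \<and> y = s \<otimes> a [^] n"
  obtains x R where "x \<in> carrier G" "finite R" "R \<subseteq> carrier G"
    "\<And>y. y \<in> carrier G \<Longrightarrow> \<exists>r\<in>R. \<exists>n::int. y = r \<otimes> x [^] n"
proof (cases "\<exists>x\<in>carrier G. \<forall>n::int. x [^] n = \<one> \<longrightarrow> n = 0")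
  case True
  then obtain x where x: "x \<in> carrier G" "\<And>n::int. x [^] n = \<one> \<Longrightarrow> n = 0" by blast
  define D' where "D' = {(s, a) \<in> D. \<exists>v>0. \<exists>w::int. a [^] (v::int) = x [^] w}"
  have "\<exists>v. d \<in> D' \<longrightarrow> v > 0 \<and> (\<exists>w::int. snd d [^] (v::int) = x [^] w)" for d
    unfolding D'_def by (cases d) simp
  then obtain v where v: "\<And>d. d \<in> D' \<Longrightarrow> v d > 0 \<and> (\<exists>w::int. snd d [^] (v d :: int) = x [^] w)" by metis
  define R where "R = (\<Union>d\<in>D'. (\<lambda>i. fst d \<otimes> snd d [^] i) ` {0..<v d})"
  have D'D: "D' \<subseteq> D" by (auto simp: D'_def)
  show ?thesis
  proof
    show "x \<in> carrier G" by fact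
    show "finite R" using D(1) D'D finite_subset unfolding R_def by auto
    show "R \<subseteq> carrier G" using D(2) D'D unfolding R_def by fastforce
  next
    fix b assume b: "b \<in> carrier G"
    have "\<exists>d n. d \<in> D \<and> b \<otimes> x [^] int m = fst d \<otimes> snd d [^] (n::int)" for m
    proof -
      obtain s a and n :: int where "(s, a) \<in> D" "b \<otimes> x [^] int m = s \<otimes> a [^] n"
        using cov[of "b \<otimes> x [^] int m"] b x by blast
      then have "(s, a) \<in> D \<and> b \<otimes> x [^] int m = fst (s, a) \<otimes> snd (s, a) [^] n" by simp
      then show ?thesis by blast
    qed
    then obtain d n where dn: "\<And>m. d m \<in> D" "\<And>m. b \<otimes> x [^] int m = fst (d m) \<otimes> snd (d m) [^] (n m :: int)"
      by metis
    have "\<not> inj d" using D(1) dn(1) by (meson finite_subset finite_imageD image_subsetI infinite_UNIV_nat)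
    then obtain i j where ij: "d i = d j" "i < j" by (metis injI linorder_neqE_nat)
    define s a where "s = fst (d i)" and "a = snd (d i)"
    have sa: "(s, a) \<in> D" "s \<in> carrier G" "a \<in> carrier G" using dn(1)[of i] D(2) by (auto simp: s_def a_def)
    have e: "b \<otimes> x [^] int i = s \<otimes> a [^] n i" "b \<otimes> x [^] int j = s \<otimes> a [^] n j"
      using dn(2)[of i] dn(2)[of j] ij(1) by (simp_all add: s_def a_def)
    have "x [^] (int j - int i) = (b \<otimes> x [^] int j) \<otimes> inv (b \<otimes> x [^] int i)"
      using b x(1) by (simp add: mult_inv_mult int_pow_diff)
    also have "\<dots> = a [^] (n j - n i)" unfolding e using sa by (simp add: mult_inv_mult int_pow_diff)
    finally have xa: "x [^] (int j - int i) = a [^] (n j - n i)" .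
    then have ne: "n j - n i \<noteq> 0" using x(2)[of "int j - int i"] ij(2) by auto
    have "\<exists>v>0. \<exists>w::int. a [^] (v::int) = x [^] w"
    proof (cases "n j - n i > 0")
      case True then show ?thesis using xa by metis
    next
      case False
      have "a [^] (- (n j - n i)) = x [^] (- (int j - int i))"
        using xa sa(3) x(1) by (simp only: int_pow_neg)
      moreover have "- (n j - n i) > 0" using False ne by simp
      ultimately show ?thesis by blast
    qed
    then have d': "(s, a) \<in> D'" using sa(1) by (simp add: D'_def)
    obtain w :: int where w: "v (s, a) > 0" "a [^] v (s, a) = x [^] w" using v[OF d'] by auto
    let ?v = "v (s, a)"
    have "b = (s \<otimes> a [^] n i) \<otimes> inv (x [^] int i)"
      unfolding e(1)[symmetric] using b x(1) by (simp add: m_assoc)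
    also have "\<dots> = (s \<otimes> a [^] (n i mod ?v)) \<otimes> ((x [^] w) [^] (n i div ?v) \<otimes> inv (x [^] int i))"
      using int_pow_divmod[OF sa(3), of "n i" ?v] sa x(1) by (simp add: w(2) m_assoc)
    also have "(x [^] w) [^] (n i div ?v) \<otimes> inv (x [^] int i) = x [^] (w * (n i div ?v) - int i)"
      using x(1) by (simp add: int_pow_pow int_pow_diff)
    finally have "b = (s \<otimes> a [^] (n i mod ?v)) \<otimes> x [^] (w * (n i div ?v) - int i)" .
    moreover have "s \<otimes> a [^] (n i mod ?v) \<in> R"
      unfolding R_def using d' w(1) by (intro UN_I[OF d']) auto
    ultimately show "\<exists>r\<in>R. \<exists>n::int. b = r \<otimes> x [^] n" by blast
  qed
next
  case False
  have tors: "\<exists>w>0::int. a [^] w = \<one>" if a: "a \<in> carrier G" for a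
  proof -
    obtain n :: int where n: "a [^] n = \<one>" "n \<noteq> 0" using False a by blast
    show ?thesis
    proof (cases "n > 0")
      case True then show ?thesis using n by blast
    next
      case False
      then have "a [^] (- n) = \<one>" "- n > 0" using n a by (auto simp: int_pow_neg)
      then show ?thesis by blast
    qed
  qed
  have "\<exists>w. a \<in> carrier G \<longrightarrow> w > 0 \<and> a [^] (w::int) = \<one>" for a using tors by blast
  then obtain w where w: "\<And>a. a \<in> carrier G \<Longrightarrow> w a > 0 \<and> a [^] (w a :: int) = \<one>" by metis
  define R where "R = (\<Union>d\<in>D. (\<lambda>i. fst d \<otimes> snd d [^] i) ` {0..<w (snd d)})"
  show ?thesis
  proof
    show "\<one> \<in> carrier G" by simp
    show "finite R" using D(1) unfolding R_def by auto
    show "R \<subseteq> carrier G" using D(2) unfolding R_def by fastforce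
  next
    fix y assume y: "y \<in> carrier G"
    obtain s a and n :: int where sa: "(s, a) \<in> D" "y = s \<otimes> a [^] n" using cov[OF y] by blast
    have c: "s \<in> carrier G" "a \<in> carrier G" using sa(1) D(2) by auto
    have "a [^] n = a [^] (n mod w a)" using int_pow_divmod[OF c(2), of n "w a"] w[OF c(2)] c by simp
    then have "y = (s \<otimes> a [^] (n mod w a)) \<otimes> \<one> [^] (0::int)" using sa(2) c by simp
    moreover have "s \<otimes> a [^] (n mod w a) \<in> R"
      unfolding R_def using w[OF c(2)] by (intro UN_I[OF sa(1)]) auto
    ultimately show "\<exists>r\<in>R. \<exists>n::int. y = r \<otimes> \<one> [^] n" by blast
  qed
qed

section \<open>Abelian normal subgroups with virtually cyclic quotient\<close>

text \<open>The conjugating elements in \<open>hit\<close> are taken from \<open>\<langle>c\<rangle>A\<close>. When this subgroup has finite index, a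
  covering under conjugation by all of \<open>G\<close> can be turned into one of this kind by adding finitely
  many conjugates of its members (\<open>cofinite_step\<close>).\<close>

locale covered_extension = normal A G for A and G (structure) +
  fixes c Hs
  assumes A_comm: "\<lbrakk>x \<in> A; y \<in> A\<rbrakk> \<Longrightarrow> x \<otimes> y = y \<otimes> x"
    and c: "c \<in> carrier G"
    and Hs_finite: "finite Hs"
    and Hs: "H \<in> Hs \<Longrightarrow> subgroup H G \<and> almost_cyclic G H"
    and hit: "g \<in> carrier G \<Longrightarrow> \<exists>H\<in>Hs. \<exists>n::int. \<exists>a\<in>A. (c [^] n \<otimes> a) \<otimes> g \<otimes> inv (c [^] n \<otimes> a) \<in> H"
begin

abbreviation "A' \<equiv> G\<lparr>carrier := A\<rparr>"

definition act :: "int \<Rightarrow> 'a \<Rightarrow> 'a" where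
  "act j x = c [^] j \<otimes> x \<otimes> inv (c [^] j)"

lemma A_carrier: "x \<in> A \<Longrightarrow> x \<in> carrier G" by (rule mem_carrier)

lemma comm_group_A: "comm_group A'"
  using subgroup_is_group[OF is_group] A_comm by (intro group.group_comm_groupI) simp_all

lemma act_A: "x \<in> A \<Longrightarrow> act j x \<in> A"
  using inv_op_closed2[of "c [^] j" x] c by (simp add: act_def)

lemma act_mult: "\<lbrakk>x \<in> carrier G; y \<in> carrier G\<rbrakk> \<Longrightarrow> act j (x \<otimes> y) = act j x \<otimes> act j y"
  using c by (simp add: act_def m_assoc mult_inv_cancel_left)

lemma act_add: "x \<in> carrier G \<Longrightarrow> act (i + j) x = act i (act j x)"
  using c by (simp add: act_def int_pow_mult inv_mult_group m_assoc)

sublocale Md: int_module A' act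
proof (intro int_module.intro int_module_axioms.intro comm_group_A)
  fix x j assume "x \<in> carrier A'"
  then show "act j x \<in> carrier A'" by (simp add: act_A)
next
  fix x y j assume "x \<in> carrier A'" "y \<in> carrier A'"
  then show "act j (x \<otimes>\<^bsub>A'\<^esub> y) = act j x \<otimes>\<^bsub>A'\<^esub> act j y" by (simp add: act_mult A_carrier)
next
  fix x i j assume "x \<in> carrier A'"
  then show "act (i + j) x = act i (act j x)" by (simp add: act_add A_carrier)
next
  fix x assume "x \<in> carrier A'"
  then show "act 0 x = x" by (simp add: act_def A_carrier)
qed

lemma pow_A: "x \<in> A \<Longrightarrow> x [^]\<^bsub>A'\<^esub> (n::int) = x [^] n"
  using int_pow_consistent[OF is_subgroup] by simp

lemma subgroup_A: "subgroup A G" by (rule is_subgroup)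

text \<open>As \<open>A\<close> is abelian, elements of \<open>\<langle>c\<rangle>A\<close> act on \<open>A\<close> as powers of \<open>c\<close> do. So every element of \<open>A\<close> is moved
  by a power of \<open>c\<close> into \<open>H \<inter> A\<close> for some \<open>H\<close> in \<open>Hs\<close>.\<close>

lemma covered_by_cyclic_cosets: obtains D where "covered_int_module A' act D"
proof -
  have "\<exists>D. finite D \<and> D \<subseteq> (H \<inter> A) \<times> (H \<inter> A) \<and> (\<forall>y\<in>H \<inter> A. \<exists>s a. \<exists>n::int. (s, a) \<in> D \<and> y = s \<otimes> a [^] n) \<and>
      (\<forall>s a. (s, a) \<in> D \<longrightarrow> (\<exists>u>0. \<exists>m::int. s [^] (u::int) = a [^] m))" if H: "H \<in> Hs" for H
  proof -
    have "subgroup (H \<inter> A) G" using Hs[OF H] subgroup_A subgroups_Inter_pair by blast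
    then obtain D where "finite D" "D \<subseteq> (H \<inter> A) \<times> (H \<inter> A)"
      "\<And>y. y \<in> H \<inter> A \<Longrightarrow> \<exists>s a. \<exists>n::int. (s, a) \<in> D \<and> y = s \<otimes> a [^] n"
      "\<And>s a. (s, a) \<in> D \<Longrightarrow> \<exists>u>0. \<exists>m::int. s [^] (u::int) = a [^] m"
      using Hs[OF H] subgroup_of_almost_cyclic[of H "H \<inter> A"] by blast
    then show ?thesis by (intro exI[of _ D]) auto
  qed
  then obtain D where D: "\<And>H. H \<in> Hs \<Longrightarrow> finite (D H) \<and> D H \<subseteq> (H \<inter> A) \<times> (H \<inter> A) \<and>
      (\<forall>y\<in>H \<inter> A. \<exists>s a. \<exists>n::int. (s, a) \<in> D H \<and> y = s \<otimes> a [^] n) \<and>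
      (\<forall>s a. (s, a) \<in> D H \<longrightarrow> (\<exists>u>0. \<exists>m::int. s [^] (u::int) = a [^] m))" by metis
  have in_A: "s \<in> A \<and> a \<in> A" if "(s, a) \<in> (\<Union>H\<in>Hs. D H)" for s a using D that by blast
  have "covered_int_module A' act (\<Union>H\<in>Hs. D H)"
  proof (intro covered_int_module.intro Md.int_module_axioms covered_int_module_axioms.intro)
    show "finite (\<Union>H\<in>Hs. D H)" using D Hs_finite by auto
  next
    fix s a assume "(s, a) \<in> (\<Union>H\<in>Hs. D H)"
    then show "s \<in> carrier A' \<and> a \<in> carrier A'" using in_A by simp
  next
    fix y assume "y \<in> carrier A'"
    then have y: "y \<in> A" by simp
    obtain H n x where H: "H \<in> Hs" "x \<in> A" "(c [^] (n::int) \<otimes> x) \<otimes> y \<otimes> inv (c [^] n \<otimes> x) \<in> H"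
      using hit[OF A_carrier[OF y]] by blast
    have "(c [^] n \<otimes> x) \<otimes> y \<otimes> inv (c [^] n \<otimes> x) = act n (x \<otimes> y \<otimes> inv x)"
      using A_carrier[OF y] A_carrier[OF H(2)] c by (simp add: act_def inv_mult_group m_assoc)
    also have "x \<otimes> y \<otimes> inv x = y" using A_comm[OF H(2) y] A_carrier[OF y] A_carrier[OF H(2)]
      by (simp add: m_assoc)
    finally have "act n y \<in> H \<inter> A" using H(3) act_A[OF y] by simp
    then obtain s a and m :: int where sa: "(s, a) \<in> D H" "act n y = s \<otimes> a [^] m" using D[OF H(1)] by blast
    have mem: "(s, a) \<in> (\<Union>H\<in>Hs. D H)" using sa(1) H(1) by blast
    then have "act n y = s \<otimes>\<^bsub>A'\<^esub> a [^]\<^bsub>A'\<^esub> m" using sa(2) in_A pow_A by simp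
    then show "\<exists>s a j n. (s, a) \<in> (\<Union>H\<in>Hs. D H) \<and> act j y = s \<otimes>\<^bsub>A'\<^esub> a [^]\<^bsub>A'\<^esub> (n::int)" using mem by blast
  next
    fix s a assume mem: "(s, a) \<in> (\<Union>H\<in>Hs. D H)"
    then obtain u m :: int where "u > 0" "s [^] u = a [^] m" using D by blast
    then show "\<exists>u>0. \<exists>m::int. s [^]\<^bsub>A'\<^esub> (u::int) = a [^]\<^bsub>A'\<^esub> m" using pow_A in_A[OF mem] by auto
  qed
  then show ?thesis using that by blast
qed

text \<open>The exponent \<open>k\<close> is unique if \<open>c\<close> has infinite order modulo \<open>A\<close>. As a relation, height behaves
  additively without this condition.\<close>

definition height :: "int \<Rightarrow> 'a \<Rightarrow> bool" where
  "height k x \<longleftrightarrow> x \<in> carrier G \<and> A #> x = A #> c [^] k"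

lemma height_carrier: "height k x \<Longrightarrow> x \<in> carrier G" by (simp add: height_def)

lemma height_c: "height k (c [^] k)" using c by (simp add: height_def)

lemma height_A: "a \<in> A \<Longrightarrow> height 0 a"
  using A_carrier coset_join2[OF _ subgroup_A] by (simp add: height_def)

lemma A_of_height_0: "height 0 x \<Longrightarrow> x \<in> A"
  unfolding height_def using rcos_self[OF _ subgroup_A, of x] coset_join2[OF _ subgroup_A, of \<one>] by simp

lemma height_mult: "\<lbrakk>height k x; height l y\<rbrakk> \<Longrightarrow> height (k + l) (x \<otimes> y)"
  unfolding height_def using c rcos_sum[of x y] rcos_sum[of "c [^] k" "c [^] l"] by (simp add: int_pow_mult)

lemma height_pow: assumes "height k x" shows "height (k * n) (x [^] (n::int))"
proof -
  interpret F: group_hom G "G Mod A" "\<lambda>x. A #> x"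
    by (intro group_hom.intro group_hom_axioms.intro is_group factorgroup_is_group r_coset_hom_Mod)
  show ?thesis
    using assms c F.hom_int_pow[of x n] F.hom_int_pow[of "c [^] k" n] by (simp add: height_def int_pow_pow)
qed

lemma height_inv: "height k x \<Longrightarrow> height (- k) (inv x)"
  using height_pow[of k x "- 1"] height_carrier by (simp add: int_pow_neg)

lemma height_ex: assumes "height k x" obtains a where "a \<in> A" "x = a \<otimes> c [^] k"
proof -
  have "x \<in> A #> c [^] k" using rcos_self[OF height_carrier[OF assms] subgroup_A] assms by (simp add: height_def)
  then show ?thesis using that by (auto simp: r_coset_def)
qed

lemma height_conj: "\<lbrakk>height k x; height l z\<rbrakk> \<Longrightarrow> height k (z \<otimes> x \<otimes> inv z)"
  using height_mult[OF height_mult height_inv, of l z k x l z] by simp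

lemma pow_twisted:
  assumes a: "a \<in> A"
  shows "(a \<otimes> c [^] int L) [^] int q = Md.shift_norm L q a \<otimes> c [^] int (q * L)"
proof (induction q)
  case 0 then show ?case by simp
next
  case (Suc q)
  have N: "Md.shift_norm L q a \<in> carrier G" using Md.shift_norm_closed[of a L q] a A_carrier by simp
  have ac: "a \<in> carrier G" using a A_carrier by simp
  let ?e = "c [^] int (q * L)"
  have "(a \<otimes> c [^] int L) [^] int (Suc q) = (a \<otimes> c [^] int L) [^] int q \<otimes> (a \<otimes> c [^] int L)"
    using int_pow_mult[of "a \<otimes> c [^] int L" "int q" 1] ac c by (simp add: add.commute)
  also have "\<dots> = Md.shift_norm L q a \<otimes> act (int (q * L)) a \<otimes> (?e \<otimes> c [^] int L)"
    unfolding Suc act_def[of _ a] using N ac c by (simp add: m_assoc mult_inv_cancel_left)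
  also have "?e \<otimes> c [^] int L = c [^] int (Suc q * L)"
    using c int_pow_mult[of c "int (q * L)" "int L"] by (simp add: add.commute)
  finally show ?case by simp
qed

lemma torsion_A: "Md.torsion = {t \<in> A. \<exists>n>0. t [^] (n::int) = \<one>}"
  unfolding Md.torsion_def using pow_A by auto

text \<open>Both \<open>t\<close> and \<open>h\<close> have positive powers in the same cyclic group. If \<open>t\<close> had infinite order, then some
  nontrivial power of \<open>h\<close> would be a power of \<open>t\<close>, hence of height zero.\<close>

lemma torsion_of_mem:
  assumes nz: "\<And>n::int. n \<noteq> 0 \<Longrightarrow> c [^] n \<notin> A"
    and H: "subgroup H G" "almost_cyclic G H" and h: "h \<in> H" "height k h" "k \<noteq> 0"
    and t: "t \<in> H" "t \<in> A"
  shows "\<exists>n>0. t [^] (n::int) = \<one>"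
proof -
  obtain d R where d: "d \<in> H" and R: "finite R" "R \<subseteq> carrier G"
    and cov: "\<And>h. h \<in> H \<Longrightarrow> \<exists>r\<in>R. \<exists>n::int. h = r \<otimes> d [^] n"
    using H(2) unfolding almost_cyclic_def by auto
  have dc: "d \<in> carrier G" "t \<in> carrier G" "h \<in> carrier G"
    using subgroup.mem_carrier[OF H(1)] d t h by auto
  obtain u i :: int where u: "u > 0" "t [^] u = d [^] i" using power_in_cyclic[OF H(1) d R cov t(1)] by blast
  obtain v j :: int where v: "v > 0" "h [^] v = d [^] j" using power_in_cyclic[OF H(1) d R cov h(1)] by blast
  have "t [^] (u * j) = h [^] (v * i)"
    using arg_cong[OF u(2), of "\<lambda>x. x [^] j"] arg_cong[OF v(2), of "\<lambda>x. x [^] i"] dc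
    by (simp add: int_pow_pow mult.commute)
  moreover have "t [^] (u * j) \<in> A" using subgroup_A t(2) by (rule subgroup_int_pow_closed)
  ultimately have "height 0 (h [^] (v * i))" using height_A by simp
  then have "A #> c [^] (k * (v * i)) = A #> c [^] (0::int)" using height_pow[OF h(2), of "v * i"] by (simp add: height_def)
  then have "height 0 (c [^] (k * (v * i)))" using c by (simp add: height_def)
  then have "k * (v * i) = 0" using A_of_height_0 nz by blast
  then have "i = 0" using h(3) v(1) by simp
  then show ?thesis using u by auto
qed

text \<open>The height of \<open>b \<otimes> c [^] (q * L)\<close> is a multiple of the chosen height of an element \<open>h\<close> in the member
  \<open>H\<close> of the family that contains a conjugate of it. A power \<open>y\<close> of \<open>h\<close> has height \<open>L\<close>, and \<open>y [^] q\<close>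
  has the height of the conjugate; the two differ by an element of \<open>H \<inter> A\<close>, which is torsion.\<close>

lemma norms_onto:
  assumes nz: "\<And>n::int. n \<noteq> 0 \<Longrightarrow> c [^] n \<notin> A"
  obtains L :: nat where "\<And>b q. b \<in> A \<Longrightarrow> q > 0 \<Longrightarrow> \<exists>t\<in>Md.torsion. \<exists>a\<in>A. b = t \<otimes> Md.shift_norm L q a"
proof -
  \<comment> \<open>A subgroup without elements of positive height gets the dummy value 1.\<close>
  have "\<exists>m::nat. m > 0 \<and> ((\<exists>h\<in>H. \<exists>k::nat. k > 0 \<and> height (int k) h) \<longrightarrow> (\<exists>h\<in>H. height (int m) h))" for H
  proof (cases "\<exists>h\<in>H. \<exists>k::nat. k > 0 \<and> height (int k) h")
    case False
    then show ?thesis using zero_less_one by metis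
  qed blast
  then obtain m :: "'a set \<Rightarrow> nat" where m: "\<And>H. m H > 0"
      "\<And>H h k. h \<in> H \<Longrightarrow> k > 0 \<Longrightarrow> height (int k) h \<Longrightarrow> \<exists>h\<in>H. height (int (m H)) h" by metis
  define L where "L = prod m Hs"
  have L: "L > 0" unfolding L_def using m(1) by (intro prod_pos) auto
  show ?thesis
  proof (rule that)
    fix b and q :: nat assume b: "b \<in> A" and q: "q > 0"
    let ?g = "b \<otimes> c [^] int (q * L)"
    have g: "?g \<in> carrier G" "height (int (q * L)) ?g"
      using height_mult[OF height_A[OF b] height_c, of "int (q * L)"] height_carrier by auto
    obtain H n x where H: "H \<in> Hs" "x \<in> A" "(c [^] (n::int) \<otimes> x) \<otimes> ?g \<otimes> inv (c [^] n \<otimes> x) \<in> H"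
      using hit[OF g(1)] by blast
    define z where "z = c [^] n \<otimes> x"
    have z: "z \<in> carrier G" "height n z"
      using height_mult[OF height_c height_A[OF H(2)], of n] height_carrier by (auto simp: z_def)
    define g' where "g' = z \<otimes> ?g \<otimes> inv z"
    have g'H: "g' \<in> H" using H(3) by (simp add: g'_def z_def)
    have dg': "height (int (q * L)) g'" unfolding g'_def using height_conj[OF g(2) z(2)] .
    have subH: "subgroup H G" "almost_cyclic G H" using Hs[OF H(1)] by auto
    obtain h where h: "h \<in> H" "height (int (m H)) h" using m(2)[OF g'H _ dg'] q L by auto
    have "m H dvd L" unfolding L_def using H(1) Hs_finite by (simp add: dvd_prodI)
    then obtain l where l: "L = m H * l" ..
    define y where "y = h [^] int l"
    have y: "y \<in> H" "height (int L) y"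
      using subgroup_int_pow_closed[OF subH(1) h(1)] height_pow[OF h(2), of "int l"] by (simp_all add: y_def l)
    have yc: "y \<in> carrier G" using y height_carrier by blast
    define w where "w = g' \<otimes> inv (y [^] int q)"
    have yq: "y [^] int q \<in> H" using subgroup_int_pow_closed[OF subH(1) y(1)] .
    have "height (int (q * L) + - (int L * int q)) w"
      unfolding w_def by (intro height_mult dg' height_inv height_pow y)
    then have "w \<in> A" using A_of_height_0 by (simp add: mult.commute)
    moreover have "w \<in> H" unfolding w_def
      using subgroup.m_closed[OF subH(1) g'H subgroup.m_inv_closed[OF subH(1) yq]] .
    ultimately obtain k :: int where k: "k > 0" "w [^] k = \<one>"
      using torsion_of_mem[OF nz subH h] m(1)[of H] by auto
    have wc: "w \<in> carrier G" using A_carrier[OF \<open>w \<in> A\<close>] .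
    define t where "t = inv z \<otimes> w \<otimes> z"
    interpret f: group_hom G G "\<lambda>x. inv z \<otimes> x \<otimes> z"
      using z(1) by unfold_locales (auto simp: hom_def m_assoc mult_inv_cancel_left)
    have "t \<in> A" unfolding t_def using inv_op_closed1[OF z(1) \<open>w \<in> A\<close>] .
    moreover have "t [^] k = \<one>" unfolding t_def using f.hom_int_pow[OF wc, of k] k(2) by simp
    ultimately have t: "t \<in> Md.torsion" using k(1) by (auto simp: torsion_A)
    define v where "v = inv z \<otimes> y \<otimes> z"
    have "height (int L) v" unfolding v_def using height_conj[OF y(2) height_inv[OF z(2)]] z(1) by simp
    then obtain a where a: "a \<in> A" "v = a \<otimes> c [^] int L" using height_ex by blast
    have "g' = w \<otimes> y [^] int q" unfolding w_def using height_carrier[OF dg'] yc by (simp add: m_assoc)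
    then have "inv z \<otimes> g' \<otimes> z = t \<otimes> v [^] int q"
      unfolding t_def v_def using f.hom_mult[of w "y [^] int q"] f.hom_int_pow[OF yc, of "int q"] wc yc by simp
    moreover have "inv z \<otimes> g' \<otimes> z = ?g" unfolding g'_def using z(1) g(1) by (simp add: m_assoc mult_inv_cancel_left)
    ultimately have "?g = t \<otimes> (Md.shift_norm L q a \<otimes> c [^] int (q * L))"
      unfolding a(2) pow_twisted[OF a(1)] by simp
    moreover have N: "Md.shift_norm L q a \<in> A" using Md.shift_norm_closed[of a L q] a(1) by simp
    ultimately have "b \<otimes> c [^] int (q * L) = (t \<otimes> Md.shift_norm L q a) \<otimes> c [^] int (q * L)"
      using A_carrier[OF N] A_carrier[OF \<open>t \<in> A\<close>] c by (simp add: m_assoc)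
    then have "b = t \<otimes> Md.shift_norm L q a"
      using right_cancel[of "c [^] int (q * L)" b "t \<otimes> Md.shift_norm L q a"] A_carrier[OF b] A_carrier[OF N] A_carrier[OF \<open>t \<in> A\<close>] c
      by simp
    then show "\<exists>t\<in>Md.torsion. \<exists>a\<in>A. b = t \<otimes> Md.shift_norm L q a" using t a(1) by blast
  qed
qed

theorem finite_or_finite_index:
  "finite A \<or> (\<exists>n>0. c [^] (n::int) \<in> A)"
proof (cases "\<exists>n>0. c [^] (n::int) \<in> A")
  case False
  have nz: "c [^] n \<notin> A" if "n \<noteq> 0" for n :: int
  proof
    assume cn: "c [^] n \<in> A"
    have "c [^] (- n) \<in> A" using m_inv_closed[OF cn] c by (simp add: int_pow_neg)
    then have "\<not> n > 0" "\<not> - n > 0" using False cn by blast+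
    then show False using that by simp
  qed
  obtain L :: nat where L: "\<And>b q. b \<in> A \<Longrightarrow> q > 0 \<Longrightarrow> \<exists>t\<in>Md.torsion. \<exists>a\<in>A. b = t \<otimes> Md.shift_norm L q a"
    using norms_onto[OF nz] by blast
  obtain D where "covered_int_module A' act D" using covered_by_cyclic_cosets by blast
  then interpret C: covered_int_module A' act D .
  have "carrier A' = Md.torsion" using L by (intro C.torsion_of_norms_onto[of L]) simp
  then have "finite (carrier A')" by (rule C.finite_of_torsion)
  then show ?thesis by simp
qed simp

text \<open>If \<open>c [^] n\<close> lies in \<open>A\<close> with \<open>n > 0\<close>, it acts trivially on \<open>A\<close>, so that shifts by \<open>0, \<dots>, n - 1\<close> are
  enough to cover \<open>A\<close> and \<open>cyclic_cosets_cover\<close> applies.\<close>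

lemma virtually_cyclic_of_cofinite:
  assumes cof: "cofinite_mod G c A"
  shows "\<exists>d. cofinite_mod G d {\<one>}"
proof -
  obtain R where R: "finite R" "R \<subseteq> carrier G"
    and cov: "\<And>g. g \<in> carrier G \<Longrightarrow> \<exists>r\<in>R. \<exists>n::int. \<exists>a\<in>A. g = r \<otimes> (c [^] n \<otimes> a)"
    using cof by (auto simp: cofinite_mod_def)
  show ?thesis
  proof (cases "finite A")
    case True
    let ?R = "(\<lambda>(r, a). r \<otimes> a) ` (R \<times> A)"
    have "\<exists>r\<in>?R. \<exists>n::int. \<exists>a\<in>{\<one>}. g = r \<otimes> (c [^] n \<otimes> a)" if g: "g \<in> carrier G" for g
    proof -
      obtain r n a where *: "r \<in> R" "a \<in> A" "g = r \<otimes> (c [^] (n::int) \<otimes> a)" using cov[OF g] by blast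
      have "g = (r \<otimes> act n a) \<otimes> (c [^] n \<otimes> \<one>)"
        using * R(2) c A_carrier by (auto simp: act_def m_assoc mult_inv_cancel_left subset_eq)
      moreover have "r \<otimes> act n a \<in> ?R" using *(1) act_A[OF *(2)] by force
      ultimately show ?thesis by blast
    qed
    moreover have "finite ?R" "?R \<subseteq> carrier G" using R True A_carrier by auto
    ultimately have "cofinite_mod G c {\<one>}" unfolding cofinite_mod_def using c by blast
    then show ?thesis by blast
  next
    case False
    then obtain n :: int where n: "n > 0" "c [^] n \<in> A" using finite_or_finite_index by blast
    obtain D where "covered_int_module A' act D" using covered_by_cyclic_cosets by blast
    then interpret C: covered_int_module A' act D .
    have cnA: "(c [^] n) [^] k \<in> A" for k :: int using subgroup_A n(2) by (rule subgroup_int_pow_closed)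
    have act_n: "act (n * k) y = y" if y: "y \<in> A" for k y
      using A_comm[OF cnA[of k] y] A_carrier[OF y] c by (simp add: act_def int_pow_pow m_assoc)
    have act_mod: "act j y = act (j mod n) y" if y: "y \<in> A" for j y
    proof -
      have "j = j mod n + n * (j div n)" by simp
      then have "act j y = act (j mod n) (act (n * (j div n)) y)" using act_add A_carrier[OF y] by metis
      then show ?thesis using act_n[OF y] by simp
    qed
    define D' where "D' = (\<lambda>(j, s, a). (act j s, act j a)) ` ({0..<n} \<times> D)"
    have "finite D'" unfolding D'_def using C.D_finite by simp
    moreover have "D' \<subseteq> carrier A' \<times> carrier A'"
      unfolding D'_def using C.D_carrier act_A by auto
    moreover have "\<exists>s a. \<exists>k::int. (s, a) \<in> D' \<and> y = s \<otimes>\<^bsub>A'\<^esub> a [^]\<^bsub>A'\<^esub> k" if y: "y \<in> carrier A'" for y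
    proof -
      obtain s a j and k :: int where *: "(s, a) \<in> D" "act j y = s \<otimes>\<^bsub>A'\<^esub> a [^]\<^bsub>A'\<^esub> k" using C.D_cover[OF y] by blast
      have sa: "s \<in> carrier A'" "a \<in> carrier A'" using C.D_carrier[OF *(1)] by auto
      have "y = act (- j) (act j y)" using Md.M_minus[OF y] by simp
      also have "\<dots> = act (- j) s \<otimes>\<^bsub>A'\<^esub> act (- j) a [^]\<^bsub>A'\<^esub> k"
        unfolding *(2) using sa Md.M_mult[of s "a [^]\<^bsub>A'\<^esub> k"] Md.M_pow[OF sa(2)] Md.int_pow_closed[OF sa(2)] by simp
      finally have "y = act ((- j) mod n) s \<otimes>\<^bsub>A'\<^esub> act ((- j) mod n) a [^]\<^bsub>A'\<^esub> k"
        using act_mod[of s "- j"] act_mod[of a "- j"] sa by simp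
      moreover have "(act ((- j) mod n) s, act ((- j) mod n) a) \<in> D'"
        unfolding D'_def using *(1) n(1) by (intro image_eqI[of _ _ "((- j) mod n, s, a)"]) auto
      ultimately show ?thesis by blast
    qed
    ultimately obtain x R1 where x: "x \<in> carrier A'" "finite R1" "R1 \<subseteq> carrier A'"
      "\<And>y. y \<in> carrier A' \<Longrightarrow> \<exists>r\<in>R1. \<exists>n::int. y = r \<otimes>\<^bsub>A'\<^esub> x [^]\<^bsub>A'\<^esub> n"
      using Md.cyclic_cosets_cover[of D'] by blast
    have xc: "x \<in> carrier G" using x(1) A_carrier by simp
    let ?R = "(\<lambda>(r, i, s). r \<otimes> c [^] i \<otimes> s) ` (R \<times> {0..<n} \<times> R1)"
    have "\<exists>r\<in>?R. \<exists>n::int. \<exists>a\<in>{\<one>}. g = r \<otimes> (x [^] n \<otimes> a)" if g: "g \<in> carrier G" for g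
    proof -
      obtain r k a where *: "r \<in> R" "a \<in> A" "g = r \<otimes> (c [^] (k::int) \<otimes> a)" using cov[OF g] by blast
      have a': "(c [^] n) [^] (k div n) \<otimes> a \<in> A" using cnA *(2) by simp
      then obtain s and m :: int where s: "s \<in> R1" "(c [^] n) [^] (k div n) \<otimes> a = s \<otimes> x [^] m"
        using x(4)[of "(c [^] n) [^] (k div n) \<otimes> a"] pow_A x(1) by auto
      have sc: "s \<in> carrier G" using s(1) x(3) A_carrier by auto
      have rc: "r \<in> carrier G" using *(1) R(2) by blast
      have "g = r \<otimes> (c [^] (k mod n) \<otimes> ((c [^] n) [^] (k div n) \<otimes> a))"
        using *(3) int_pow_divmod[OF c, of k n] c rc A_carrier[OF *(2)] by (simp add: m_assoc)
      then have "g = (r \<otimes> c [^] (k mod n) \<otimes> s) \<otimes> (x [^] m \<otimes> \<one>)"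
        unfolding s(2) using rc sc xc c by (simp add: m_assoc)
      moreover have "r \<otimes> c [^] (k mod n) \<otimes> s \<in> ?R"
        using *(1) s(1) n(1) by (intro image_eqI[of _ _ "(r, k mod n, s)"]) auto
      ultimately show ?thesis by blast
    qed
    moreover have "finite ?R" using R(1) x(2) by simp
    moreover have "?R \<subseteq> carrier G"
    proof -
      have "r \<in> carrier G" if "r \<in> R" for r using that R(2) by blast
      moreover have "r \<in> carrier G" if "r \<in> R1" for r using that x(3) A_carrier by auto
      ultimately show ?thesis using c by auto
    qed
    ultimately have "cofinite_mod G x {\<one>}" unfolding cofinite_mod_def using xc by blast
    then show ?thesis by blast
  qed
qed

end

section \<open>Conjugation-covered solvable groups\<close>

lemma conj_coveredE:
  fixes G (structure)
  assumes "conj_covered G"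
  obtains Hs where "finite Hs" "\<And>H. H \<in> Hs \<Longrightarrow> subgroup H G \<and> almost_cyclic G H"
    "\<And>g. g \<in> carrier G \<Longrightarrow> \<exists>x\<in>carrier G. \<exists>H\<in>Hs. x \<otimes> g \<otimes> inv x \<in> H"
proof -
  obtain Hs where Hs: "finite Hs" "\<forall>H\<in>Hs. subgroup H G \<and> almost_cyclic G H"
    "\<forall>g\<in>carrier G. \<exists>x\<in>carrier G. \<exists>H\<in>Hs. x \<otimes> g \<otimes> inv x \<in> H"
    using assms unfolding conj_covered_def by blast
  show thesis
  proof (rule that[of Hs])
    show "finite Hs" by fact
    show "subgroup H G \<and> almost_cyclic G H" if "H \<in> Hs" for H using Hs(2) that by (rule bspec)
    show "\<exists>x\<in>carrier G. \<exists>H\<in>Hs. x \<otimes> g \<otimes> inv x \<in> H" if "g \<in> carrier G" for g using Hs(3) that by (rule bspec)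
  qed
qed

lemma (in group) cofinite_step:
  assumes cov: "conj_covered G" and N: "A \<lhd> G" and comm: "\<And>x y. x \<in> A \<Longrightarrow> y \<in> A \<Longrightarrow> x \<otimes> y = y \<otimes> x"
    and cof: "cofinite_mod G c A"
  shows "\<exists>d. cofinite_mod G d {\<one>}"
proof -
  obtain R where R: "finite R" "R \<subseteq> carrier G" and c: "c \<in> carrier G"
    and covR: "\<And>g. g \<in> carrier G \<Longrightarrow> \<exists>r\<in>R. \<exists>n::int. \<exists>a\<in>A. g = r \<otimes> (c [^] n \<otimes> a)"
    using cof by (auto simp: cofinite_mod_def)
  obtain Hs where Hs: "finite Hs" "\<And>H. H \<in> Hs \<Longrightarrow> subgroup H G \<and> almost_cyclic G H"
    "\<And>g. g \<in> carrier G \<Longrightarrow> \<exists>x\<in>carrier G. \<exists>H\<in>Hs. x \<otimes> g \<otimes> inv x \<in> H"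
    using conj_coveredE[OF cov] by blast
  define Ks where "Ks = (\<lambda>(r, H). (\<lambda>h. inv r \<otimes> h \<otimes> inv (inv r)) ` H) ` (R \<times> Hs)"
  interpret A: normal A G by (rule N)
  have "covered_extension A G c Ks"
  proof (intro covered_extension.intro covered_extension_axioms.intro N)
    show "x \<otimes> y = y \<otimes> x" if "x \<in> A" "y \<in> A" for x y using comm that .
    show "c \<in> carrier G" by fact
    show "finite Ks" unfolding Ks_def using R Hs by simp
    show "subgroup K G \<and> almost_cyclic G K" if K: "K \<in> Ks" for K
    proof -
      obtain r H where rH: "r \<in> R" "H \<in> Hs" "K = (\<lambda>h. inv r \<otimes> h \<otimes> inv (inv r)) ` H"
        using K by (auto simp: Ks_def)
      have "inv r \<in> carrier G" using rH(1) R(2) by auto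
      then show ?thesis unfolding rH(3) using Hs(2)[OF rH(2)] by (intro almost_cyclic_conj) auto
    qed
    fix g assume g: "g \<in> carrier G"
    obtain x H where x: "x \<in> carrier G" "H \<in> Hs" "x \<otimes> g \<otimes> inv x \<in> H" using Hs(3)[OF g] by blast
    obtain r n a where r: "r \<in> R" "a \<in> A" "x = r \<otimes> (c [^] (n::int) \<otimes> a)" using covR[OF x(1)] by blast
    define z where "z = c [^] n \<otimes> a"
    have zc: "z \<in> carrier G" "r \<in> carrier G" using c r R(2) A.mem_carrier by (auto simp: z_def)
    have "z \<otimes> g \<otimes> inv z = inv r \<otimes> (x \<otimes> g \<otimes> inv x) \<otimes> inv (inv r)"
      unfolding r(3) z_def[symmetric] using zc g
      by (simp add: inv_mult_group m_assoc mult_inv_cancel_left)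
    then have "z \<otimes> g \<otimes> inv z \<in> (\<lambda>h. inv r \<otimes> h \<otimes> inv (inv r)) ` H" using x(3) by blast
    moreover have mem: "(\<lambda>h. inv r \<otimes> h \<otimes> inv (inv r)) ` H \<in> Ks" unfolding Ks_def using r(1) x(2) by blast
    ultimately show "\<exists>H\<in>Ks. \<exists>n::int. \<exists>a\<in>A. (c [^] n \<otimes> a) \<otimes> g \<otimes> inv (c [^] n \<otimes> a) \<in> H"
      unfolding z_def by (intro bexI[OF _ mem] exI bexI[OF _ r(2)])
  qed
  then show ?thesis using cof by (rule covered_extension.virtually_cyclic_of_cofinite)
qed

lemma (in group_hom) almost_cyclic_image:
  assumes "subgroup K G" "almost_cyclic G K"
  shows "almost_cyclic H (h ` K)"
proof -
  obtain d R where d: "d \<in> K" and R: "finite R" "R \<subseteq> carrier G"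
    and cov: "\<And>k. k \<in> K \<Longrightarrow> \<exists>r\<in>R. \<exists>n::int. k = r \<otimes> d [^] n"
    using assms(2) unfolding almost_cyclic_def by auto
  have dc: "d \<in> carrier G" using subgroup.mem_carrier[OF assms(1) d] .
  have "\<exists>r\<in>h ` R. \<exists>n::int. h k = r \<otimes>\<^bsub>H\<^esub> h d [^]\<^bsub>H\<^esub> n" if k: "k \<in> K" for k
  proof -
    obtain r and n :: int where rn: "r \<in> R" "k = r \<otimes> d [^] n" using cov[OF k] by blast
    have "h k = h r \<otimes>\<^bsub>H\<^esub> h d [^]\<^bsub>H\<^esub> n" unfolding rn(2) using rn(1) R(2) dc by (auto simp: hom_int_pow subset_eq)
    then show ?thesis using rn(1) by blast
  qed
  then show ?thesis unfolding almost_cyclic_def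
    using d R by (intro bexI[of _ "h d"] exI[of _ "h ` R"]) auto
qed

lemma (in group_hom) conj_covered_image:
  assumes cov: "conj_covered G" and surj: "h ` carrier G = carrier H"
  shows "conj_covered H"
proof -
  obtain Hs where Hs: "finite Hs" "\<And>K. K \<in> Hs \<Longrightarrow> subgroup K G \<and> almost_cyclic G K"
    "\<And>g. g \<in> carrier G \<Longrightarrow> \<exists>x\<in>carrier G. \<exists>K\<in>Hs. x \<otimes> g \<otimes> inv x \<in> K"
    using conj_coveredE[OF cov] by blast
  have "\<exists>x\<in>carrier H. \<exists>K\<in>(`) h ` Hs. x \<otimes>\<^bsub>H\<^esub> g \<otimes>\<^bsub>H\<^esub> inv\<^bsub>H\<^esub> x \<in> K" if g: "g \<in> carrier H" for g
  proof -
    obtain g0 where g0: "g0 \<in> carrier G" "g = h g0" using g surj by blast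
    obtain x K where x: "x \<in> carrier G" "K \<in> Hs" "x \<otimes> g0 \<otimes> inv x \<in> K" using Hs(3)[OF g0(1)] by blast
    have "h x \<otimes>\<^bsub>H\<^esub> g \<otimes>\<^bsub>H\<^esub> inv\<^bsub>H\<^esub> (h x) = h (x \<otimes> g0 \<otimes> inv x)" using x(1) g0 by simp
    then show ?thesis using x by (intro bexI[of _ "h x"] bexI[of _ "h ` K"]) auto
  qed
  moreover have "subgroup K H \<and> almost_cyclic H K" if "K \<in> (`) h ` Hs" for K
    using that Hs(2) subgroup_img_is_subgroup almost_cyclic_image by auto
  ultimately show ?thesis unfolding conj_covered_def using Hs(1) by (intro exI[of _ "(`) h ` Hs"]) auto
qed

text \<open>This is \<open>cofinite_step\<close> for the abelian normal subgroup \<open>N/N'\<close> of \<open>G/N'\<close>, with the conclusion lifted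
  to \<open>G\<close>. Stating it in \<open>G\<close> keeps the type fixed, so that it can be iterated.\<close>

lemma (in group) cofinite_mod_descent:
  assumes cov: "conj_covered G" and N: "N \<lhd> G" and N': "N' \<lhd> G" "N' \<subseteq> N"
    and comm: "\<And>x y. x \<in> N \<Longrightarrow> y \<in> N \<Longrightarrow> x \<otimes> y \<otimes> inv x \<otimes> inv y \<in> N'"
    and cof: "cofinite_mod G c N"
  shows "\<exists>d. cofinite_mod G d N'"
proof -
  interpret N': normal N' G by (rule N'(1))
  interpret N: normal N G by (rule N)
  let ?K = "G Mod N'" and ?\<pi> = "\<lambda>x. N' #> x"
  interpret K: group ?K by (rule N'.factorgroup_is_group)
  interpret \<pi>: group_hom G ?K ?\<pi>
    by (intro group_hom.intro group_hom_axioms.intro is_group K.is_group N'.r_coset_hom_Mod)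
  have surj: "?\<pi> ` carrier G = carrier ?K" by (simp add: carrier_FactGroup)
  have eq_iff: "N' #> x = N' #> y \<longleftrightarrow> x \<otimes> inv y \<in> N'" if "x \<in> carrier G" "y \<in> carrier G" for x y
  proof
    assume "N' #> x = N' #> y"
    then have "x \<in> N' #> y" using rcos_self[OF that(1) N'.is_subgroup] by simp
    then obtain a where "a \<in> N'" "x = a \<otimes> y" by (auto simp: r_coset_def)
    then show "x \<otimes> inv y \<in> N'" using that N'.mem_carrier by (simp add: m_assoc)
  next
    assume a: "x \<otimes> inv y \<in> N'"
    then have "x \<in> N' #> y" using that unfolding r_coset_def
      by (auto intro!: bexI[of _ "x \<otimes> inv y"] simp: m_assoc)
    then show "N' #> x = N' #> y" using repr_independence N'.is_subgroup that(2) by metis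
  qed
  have "\<exists>D. cofinite_mod ?K D {\<one>\<^bsub>?K\<^esub>}"
  proof (rule K.cofinite_step)
    show "conj_covered ?K" using \<pi>.conj_covered_image[OF cov surj] .
    show "?\<pi> ` N \<lhd> ?K" using N.surj_hom_normal_subgroup[OF \<pi>.group_hom_axioms surj] .
    show "x \<otimes>\<^bsub>?K\<^esub> y = y \<otimes>\<^bsub>?K\<^esub> x" if xy: "x \<in> ?\<pi> ` N" "y \<in> ?\<pi> ` N" for x y
    proof -
      obtain a b where ab: "a \<in> N" "b \<in> N" "x = ?\<pi> a" "y = ?\<pi> b" using xy by blast
      have c: "a \<in> carrier G" "b \<in> carrier G" using ab N.mem_carrier by auto
      have "(a \<otimes> b) \<otimes> inv (b \<otimes> a) = a \<otimes> b \<otimes> inv a \<otimes> inv b" using c by (simp add: inv_mult_group m_assoc)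
      then have "?\<pi> (a \<otimes> b) = ?\<pi> (b \<otimes> a)" using eq_iff[of "a \<otimes> b" "b \<otimes> a"] c comm[OF ab(1,2)] by simp
      then show ?thesis using \<pi>.hom_mult[OF c] \<pi>.hom_mult[OF c(2,1)] ab by simp
    qed
    obtain R where R: "finite R" "R \<subseteq> carrier G" and c: "c \<in> carrier G"
      and covR: "\<And>g. g \<in> carrier G \<Longrightarrow> \<exists>r\<in>R. \<exists>n::int. \<exists>a\<in>N. g = r \<otimes> (c [^] n \<otimes> a)"
      using cof by (auto simp: cofinite_mod_def)
    have "\<exists>r\<in>?\<pi> ` R. \<exists>n::int. \<exists>a\<in>?\<pi> ` N. y = r \<otimes>\<^bsub>?K\<^esub> (?\<pi> c [^]\<^bsub>?K\<^esub> n \<otimes>\<^bsub>?K\<^esub> a)"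
      if y: "y \<in> carrier ?K" for y
    proof -
      obtain g where g: "g \<in> carrier G" "y = ?\<pi> g" using y surj by blast
      obtain r n a where *: "r \<in> R" "a \<in> N" "g = r \<otimes> (c [^] (n::int) \<otimes> a)" using covR[OF g(1)] by blast
      have "y = ?\<pi> r \<otimes>\<^bsub>?K\<^esub> (?\<pi> c [^]\<^bsub>?K\<^esub> n \<otimes>\<^bsub>?K\<^esub> ?\<pi> a)"
        unfolding g(2) *(3) using c * R(2) N.mem_carrier[OF *(2)] \<pi>.hom_mult[of r "c [^] n \<otimes> a"]
          \<pi>.hom_mult[of "c [^] n" a] \<pi>.hom_int_pow[OF c, of n] by (simp add: subset_eq)
      then show ?thesis using * by blast
    qed
    then show "cofinite_mod ?K (?\<pi> c) (?\<pi> ` N)" unfolding cofinite_mod_def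
      using R \<pi>.hom_closed c by (intro conjI exI[of _ "?\<pi> ` R"]) auto
  qed
  then obtain y Rk where yR: "y \<in> carrier ?K" "finite Rk" "Rk \<subseteq> carrier ?K"
    "\<And>k. k \<in> carrier ?K \<Longrightarrow> \<exists>r\<in>Rk. \<exists>n::int. k = r \<otimes>\<^bsub>?K\<^esub> (y [^]\<^bsub>?K\<^esub> n \<otimes>\<^bsub>?K\<^esub> \<one>\<^bsub>?K\<^esub>)"
    unfolding cofinite_mod_def by auto
  obtain d where d: "d \<in> carrier G" "y = ?\<pi> d" using yR(1) surj by blast
  obtain R where R: "finite R" "R \<subseteq> carrier G" "Rk = ?\<pi> ` R"
    using yR(2,3) finite_subset_image[of Rk ?\<pi> "carrier G"] surj by auto
  have "\<exists>r\<in>R. \<exists>n::int. \<exists>a\<in>N'. g = r \<otimes> (d [^] n \<otimes> a)" if g: "g \<in> carrier G" for g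
  proof -
    obtain r and n :: int where r: "r \<in> R" "?\<pi> g = ?\<pi> r \<otimes>\<^bsub>?K\<^esub> (?\<pi> d [^]\<^bsub>?K\<^esub> n \<otimes>\<^bsub>?K\<^esub> \<one>\<^bsub>?K\<^esub>)"
      using yR(4)[OF \<pi>.hom_closed[OF g]] unfolding R(3) d(2) by blast
    have rc: "r \<in> carrier G" using r(1) R(2) by blast
    define z where "z = r \<otimes> d [^] n"
    have z: "z \<in> carrier G" using rc d by (simp add: z_def)
    have "?\<pi> d [^]\<^bsub>?K\<^esub> n \<in> carrier ?K" using K.int_pow_closed[OF \<pi>.hom_closed[OF d(1)]] .
    then have "?\<pi> g = ?\<pi> z"
      using r(2) \<pi>.hom_mult[OF rc int_pow_closed[OF d(1)], of n] \<pi>.hom_int_pow[OF d(1), of n] K.r_one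
      unfolding z_def by metis
    then have "g \<otimes> inv z \<in> N'" using eq_iff[OF g z] by simp
    then have "inv z \<otimes> (g \<otimes> inv z) \<otimes> z \<in> N'" using N'.inv_op_closed1[OF z] by blast
    then have "inv z \<otimes> g \<in> N'" using g z by (simp add: m_assoc)
    moreover have "g = r \<otimes> (d [^] n \<otimes> (inv z \<otimes> g))"
      using g z rc d mult_inv_cancel_left(2)[OF z g] by (simp add: z_def m_assoc)
    ultimately show ?thesis using r(1) by blast
  qed
  then have "cofinite_mod G d N'" unfolding cofinite_mod_def using R d(1) by blast
  then show ?thesis by blast
qed

theorem (in group) conj_covered_solvable:
  assumes cov: "conj_covered G" and sol: "solvable G"
  shows "\<exists>d. cofinite_mod G d {\<one>}"
proof -
  let ?D = "\<lambda>i. (derived G ^^ i) (carrier G)"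
  have normal: "?D i \<lhd> G" for i
    by (induction i) (auto intro: normal_self derived_is_normal)
  have "\<exists>c. cofinite_mod G c (?D i)" for i
  proof (induction i)
    case 0
    have "cofinite_mod G \<one> (carrier G)"
      unfolding cofinite_mod_def by (intro conjI exI[of _ "{\<one>}"]) auto
    then show ?case by auto
  next
    case (Suc i)
    have sub: "subgroup (?D i) G" using normal normal_imp_subgroup by blast
    obtain c where "cofinite_mod G c (?D i)" using Suc by blast
    then show ?case
    proof (rule cofinite_mod_descent[OF cov normal normal, rotated 2])
      show "?D (Suc i) \<subseteq> ?D i" using derived_incl[OF order_refl sub] by simp
      show "x \<otimes> y \<otimes> inv x \<otimes> inv y \<in> ?D (Suc i)" if "x \<in> ?D i" "y \<in> ?D i" for x y
        using that unfolding derived_def by (auto intro!: generate.incl)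
    qed
  qed
  moreover obtain n where "?D n = {\<one>}" using sol solvable_iff_trivial_derived_seq by blast
  ultimately show ?thesis by metis
qed

lemma virtually_cyclic_of_cofinite_mod:
  fixes G :: "'a monoid" (structure)
  assumes "group G" and "cofinite_mod G d {\<one>}"
  shows "virtually_cyclic G"
proof -
  interpret group G by fact
  obtain R where R: "finite R" "R \<subseteq> carrier G" and d: "d \<in> carrier G"
    and cov: "\<And>g. g \<in> carrier G \<Longrightarrow> \<exists>r\<in>R. \<exists>n::int. g = r \<otimes> (d [^] n \<otimes> \<one>)"
    using assms(2) by (auto simp: cofinite_mod_def)
  let ?C = "generate G {d}"
  have C: "?C = range (\<lambda>n::int. d [^] n)" using generate_pow[OF d] by auto
  have sub: "subgroup ?C G" using d by (intro generate_is_subgroup) simp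
  interpret C: group "G\<lparr>carrier := ?C\<rparr>" using subgroup.subgroup_is_group[OF sub is_group] .
  have dC: "d \<in> ?C" by (rule generate.incl) simp
  have "?C = range (\<lambda>n::int. d [^]\<^bsub>G\<lparr>carrier := ?C\<rparr>\<^esub> n)"
    using C int_pow_consistent[OF sub dC] by simp
  then have "cyclic_group (G\<lparr>carrier := ?C\<rparr>)" unfolding C.cyclic_group using dC by (intro bexI[of _ d]) simp_all
  moreover have "finite (rcosets ?C)"
  proof -
    have "rcosets ?C \<subseteq> (\<lambda>r. ?C #> inv r) ` R"
    proof
      fix K assume "K \<in> rcosets ?C"
      then obtain g where g: "g \<in> carrier G" "K = ?C #> g" by (auto simp: RCOSETS_def)
      obtain r and n :: int where rn: "r \<in> R" "inv g = r \<otimes> (d [^] n \<otimes> \<one>)" using cov[of "inv g"] g by auto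
      have rc: "r \<in> carrier G" using rn(1) R(2) by blast
      have "g = inv (r \<otimes> (d [^] n \<otimes> \<one>))" using rn(2) g(1) by (metis inv_inv)
      also have "\<dots> = d [^] (- n) \<otimes> inv r" using d rc by (simp add: inv_mult_group int_pow_neg)
      finally have "g = d [^] (- n) \<otimes> inv r" .
      then have "g \<in> ?C #> inv r" unfolding r_coset_def C by auto
      then have "K = ?C #> inv r" unfolding g(2) using repr_independence[OF _ _ sub] rc by simp
      then show "K \<in> (\<lambda>r. ?C #> inv r) ` R" using rn(1) by blast
    qed
    then show ?thesis using R(1) finite_subset by blast
  qed
  ultimately show ?thesis unfolding virtually_cyclic_def using sub by blast
qed

lemma polycyclic_imp_solvable:
  fixes G :: "'a monoid" (structure)
  assumes "group G" and "polycyclic G"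
  shows "solvable G"
proof -
  interpret group G by fact
  obtain n and H :: "nat \<Rightarrow> 'a set" where H: "H 0 = {\<one>}" "H n = carrier G" "\<And>i. i \<le> n \<Longrightarrow> subgroup (H i) G"
    "\<And>i. i < n \<Longrightarrow> H i \<lhd> (G\<lparr>carrier := H (Suc i)\<rparr>)" "\<And>i. i < n \<Longrightarrow> cyclic_group (G\<lparr>carrier := H (Suc i)\<rparr> Mod H i)"
    using assms(2) unfolding polycyclic_def by auto
  have "i \<le> n \<Longrightarrow> solvable_seq G (H i)" for i
  proof (induction i)
    case 0 then show ?case by (simp add: H(1) solvable_seq.unity)
  next
    case (Suc i)
    have "group (G\<lparr>carrier := H (Suc i)\<rparr> Mod H i)" using normal.factorgroup_is_group[OF H(4)] Suc.prems by simp
    then have "comm_group (G\<lparr>carrier := H (Suc i)\<rparr> Mod H i)"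
      using group.cyclic_imp_abelian_group[OF _ H(5)] Suc.prems by simp
    moreover have "solvable_seq G (H i)" using Suc by simp
    ultimately show ?case
      using H(3)[OF Suc.prems] H(4)[of i] Suc.prems solvable_seq.extension[of G "H i" "H (Suc i)"] by simp
  qed
  then show ?thesis unfolding solvable_def using H(2) by (metis order_refl)
qed

lemma abelian_by_polycyclic_imp_solvable:
  fixes G :: "'a monoid" (structure)
  assumes "group G" and "abelian_by_polycyclic G"
  shows "solvable G"
proof -
  interpret group G by fact
  obtain A where A: "A \<lhd> G" "comm_group (G\<lparr>carrier := A\<rparr>)" "polycyclic (G Mod A)"
    using assms(2) unfolding abelian_by_polycyclic_def by blast
  interpret A: normal A G by (rule A(1))
  interpret Ac: comm_group "G\<lparr>carrier := A\<rparr>" by (rule A(2))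
  let ?K = "G Mod A" and ?\<pi> = "\<lambda>x. A #> x"
  interpret K: group ?K by (rule A.factorgroup_is_group)
  interpret \<pi>: group_hom G ?K ?\<pi>
    by (intro group_hom.intro group_hom_axioms.intro is_group K.is_group A.r_coset_hom_Mod)
  have surj: "?\<pi> ` carrier G = carrier ?K" by (simp add: carrier_FactGroup)
  obtain n where n: "(derived ?K ^^ n) (carrier ?K) = {\<one>\<^bsub>?K\<^esub>}"
    using polycyclic_imp_solvable[OF K.is_group A(3)] K.solvable_iff_trivial_derived_seq by blast
  let ?D = "(derived G ^^ n) (carrier G)"
  have "?\<pi> ` ?D = {A}" using \<pi>.exp_of_derived_img[of "carrier G" n] n unfolding surj by simp
  then have DA: "?D \<subseteq> A"
  proof -
    have "x \<in> A" if x: "x \<in> ?D" for x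
    proof -
      have "x \<in> carrier G" using exp_of_derived_in_carrier[of "carrier G" n] x by auto
      then have "x \<in> A #> x" using rcos_self A.is_subgroup by blast
      also have "A #> x = A" using \<open>?\<pi> ` ?D = {A}\<close> x by blast
      finally show ?thesis .
    qed
    then show ?thesis by blast
  qed
  have "derived_set G A \<subseteq> {\<one>}"
  proof -
    have "x \<otimes> y \<otimes> inv x \<otimes> inv y = \<one>" if "x \<in> A" "y \<in> A" for x y
      using Ac.m_comm[of x y] that A.mem_carrier by (simp add: m_assoc mult_inv_cancel_left)
    then show ?thesis by blast
  qed
  then have "derived G A \<subseteq> {\<one>}" unfolding derived_def
    using generate_subgroup_incl[OF _ triv_subgroup] by blast
  then have "derived G ?D \<subseteq> {\<one>}" using mono_derived[OF DA] by blast
  moreover have "subgroup (derived G ?D) G" using exp_of_derived_in_carrier[of "carrier G" n] by (intro derived_is_subgroup) auto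
  ultimately have "(derived G ^^ Suc n) (carrier G) = {\<one>}" using subgroup.one_closed by auto
  then show ?thesis using solvable_iff_trivial_derived_seq by blast
qed

section \<open>The covering given by the Bredon condition\<close>

lemma almost_cyclic_of_virtually_cyclic:
  fixes K :: "'a monoid" (structure)
  assumes "group K" "virtually_cyclic K"
  shows "almost_cyclic K (carrier K)"
proof -
  interpret group K by fact
  obtain C where C: "subgroup C K" "cyclic_group (K\<lparr>carrier := C\<rparr>)" "finite (rcosets C)"
    using assms(2) unfolding virtually_cyclic_def by blast
  interpret C: group "K\<lparr>carrier := C\<rparr>" using subgroup.subgroup_is_group[OF C(1) is_group] .
  obtain x where x: "x \<in> C" "C = range (\<lambda>n::int. x [^]\<^bsub>K\<lparr>carrier := C\<rparr>\<^esub> n)"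
    using C(2) unfolding C.cyclic_group by auto
  have xC: "\<exists>n::int. y = x [^] n" if "y \<in> C" for y
    using that x(2) int_pow_consistent[OF C(1) x(1)] by auto
  have Cc: "C \<subseteq> carrier K" using C(1) subgroup.subset by blast
  let ?r = "\<lambda>K'. SOME y. y \<in> K'"
  have mem: "?r (C #> y) \<in> C #> y" if "y \<in> carrier K" for y
    using rcos_self[OF that C(1)] by (rule someI)
  let ?R = "(\<lambda>K'. inv (?r K')) ` (rcosets C)"
  have "\<exists>r\<in>?R. \<exists>n::int. h = r \<otimes> x [^] n" if h: "h \<in> carrier K" for h
  proof -
    obtain c where c: "c \<in> C" "?r (C #> inv h) = c \<otimes> inv h"
      using mem[of "inv h"] h by (auto simp: r_coset_def)
    have cc: "c \<in> carrier K" using c(1) Cc by blast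
    have "inv (?r (C #> inv h)) \<otimes> c = h" unfolding c(2) using h cc by (simp add: inv_mult_group m_assoc)
    moreover have "C #> inv h \<in> rcosets C" using h by (simp add: rcosetsI Cc)
    moreover obtain n :: int where "c = x [^] n" using xC[OF c(1)] by blast
    ultimately show ?thesis
      by (intro bexI[of _ "inv (?r (C #> inv h))"] exI[of _ n] imageI) auto
  qed
  moreover have "finite ?R" using C(3) by simp
  moreover have "?R \<subseteq> carrier K"
  proof -
    have "?r K' \<in> carrier K" if K': "K' \<in> rcosets C" for K'
    proof -
      obtain y where y: "y \<in> carrier K" "K' = C #> y" using K' by (auto simp: RCOSETS_def)
      then show ?thesis using mem[OF y(1)] r_coset_subset_G[OF Cc y(1)] by auto
    qed
    then show ?thesis by auto
  qed
  moreover have "x \<in> carrier K" using x(1) Cc by blast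
  ultimately show ?thesis unfolding almost_cyclic_def by (intro bexI[of _ x] exI[of _ ?R]) auto
qed

lemma almost_cyclic_of_VC:
  fixes G :: "'a monoid" (structure)
  assumes "group G" and H: "H \<in> VC G"
  shows "subgroup H G \<and> almost_cyclic G H"
proof -
  interpret group G by fact
  have sub: "subgroup H G" and vc: "virtually_cyclic (G\<lparr>carrier := H\<rparr>)" using H by (auto simp: VC_def)
  have "almost_cyclic (G\<lparr>carrier := H\<rparr>) H"
    using almost_cyclic_of_virtually_cyclic[OF subgroup.subgroup_is_group[OF sub is_group] vc] by simp
  then obtain d R where d: "d \<in> H" and R: "finite R" "R \<subseteq> H"
    "\<And>h. h \<in> H \<Longrightarrow> \<exists>r\<in>R. \<exists>n::int. h = r \<otimes> d [^]\<^bsub>G\<lparr>carrier := H\<rparr>\<^esub> n"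
    unfolding almost_cyclic_def by auto
  have "almost_cyclic G H" unfolding almost_cyclic_def
    using d R subgroup.subset[OF sub] int_pow_consistent[OF sub d] by (intro bexI[of _ d] exI[of _ R]) auto
  then show ?thesis using sub by simp
qed

lemma cyclic_in_VC:
  fixes G :: "'a monoid" (structure)
  assumes "group G" and S: "subgroup S G" and d: "d \<in> S" "\<And>s. s \<in> S \<Longrightarrow> \<exists>n::int. s = d [^] n"
  shows "S \<in> VC G"
proof -
  interpret group G by fact
  let ?S = "G\<lparr>carrier := S\<rparr>"
  have grp: "group ?S" using subgroup.subgroup_is_group[OF S is_group] .
  have dc: "s \<in> carrier G" if "s \<in> S" for s using subgroup.mem_carrier[OF S that] .
  have one: "\<one> \<in> S" using S by (rule subgroup.one_closed)
  have "\<exists>r\<in>{\<one>}. \<exists>n::int. \<exists>a\<in>{\<one>\<^bsub>?S\<^esub>}. s = r \<otimes>\<^bsub>?S\<^esub> (d [^]\<^bsub>?S\<^esub> n \<otimes>\<^bsub>?S\<^esub> a)" if s: "s \<in> carrier ?S" for s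
  proof -
    obtain n :: int where "s = d [^] n" using d(2)[of s] s by auto
    then have "s = \<one> \<otimes>\<^bsub>?S\<^esub> (d [^]\<^bsub>?S\<^esub> n \<otimes>\<^bsub>?S\<^esub> \<one>\<^bsub>?S\<^esub>)"
      using int_pow_consistent[OF S d(1), symmetric] dc[OF d(1)] by simp
    then show ?thesis by blast
  qed
  then have "cofinite_mod ?S d {\<one>\<^bsub>?S\<^esub>}" unfolding cofinite_mod_def
    using d(1) one by (intro conjI exI[of _ "{\<one>}"]) auto
  then show ?thesis unfolding VC_def using virtually_cyclic_of_cofinite_mod[OF grp] S by blast
qed

text \<open>The object \<open>G/C\<close> of the orbit category for the cyclic subgroup \<open>C\<close> generated by \<open>g\<close>. Its stabilizers are
  the conjugates of \<open>C\<close>.\<close>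

lemma coset_orbit:
  fixes G :: "'a monoid" (structure)
  assumes "group G" and g: "g \<in> carrier G"
  defines "C \<equiv> generate G {g}"
  defines "E \<equiv> (\<lambda>x. l_coset G x C) ` carrier G"
  defines "\<phi> \<equiv> \<lambda>x. \<lambda>K\<in>E. l_coset G x K"
  shows "(E, \<phi>) \<in> orb_objs G (VC G)" and "C \<in> E" and "\<phi> g C = C"
proof -
  interpret group G by fact
  have subC: "subgroup C G" unfolding C_def using g by (intro generate_is_subgroup) simp
  have Cc: "C \<subseteq> carrier G" using subC subgroup.subset by blast
  have C: "C = range (\<lambda>n::int. g [^] n)" unfolding C_def using generate_pow[OF g] by auto
  have gC: "g \<in> C" unfolding C_def by (rule generate.incl) simp
  have one_C: "l_coset G \<one> C = C" using Cc by (rule lcos_mult_one)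
  show CE: "C \<in> E" unfolding E_def using one_C by (metis image_eqI one_closed)
  have \<phi>: "\<phi> x (l_coset G y C) = l_coset G (x \<otimes> y) C" if "x \<in> carrier G" "y \<in> carrier G" for x y
    using that lcos_m_assoc[OF Cc] by (auto simp: \<phi>_def E_def)
  have \<phi>_mult: "\<phi> (x \<otimes> y) K = \<phi> x (\<phi> y K)" if "x \<in> carrier G" "y \<in> carrier G" "K \<in> E" for x y K
    using that \<phi> by (auto simp: E_def m_assoc)
  have \<phi>_E: "\<phi> x K \<in> E" if "x \<in> carrier G" "K \<in> E" for x K
    using that \<phi> by (auto simp: E_def)
  have \<phi>_one: "\<phi> \<one> K = K" if "K \<in> E" for K
    using that \<phi> by (auto simp: E_def)
  have ext: "\<phi> x \<in> extensional E" for x by (simp add: \<phi>_def)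
  have bij: "\<phi> x \<in> Bij E" if x: "x \<in> carrier G" for x
  proof -
    have "bij_betw (\<phi> x) E E"
      using \<phi>_mult[of "inv x" x] \<phi>_mult[of x "inv x"] x \<phi>_E \<phi>_one
      by (intro bij_betw_byWitness[where f' = "\<phi> (inv x)"]) auto
    then show ?thesis using ext by (simp add: Bij_def)
  qed
  have "\<phi> (x \<otimes> y) = compose E (\<phi> x) (\<phi> y)" if "x \<in> carrier G" "y \<in> carrier G" for x y
    using that \<phi>_mult ext by (intro extensionalityI[of _ E]) (auto simp: compose_eq)
  then have act: "group_action G E \<phi>"
    using bij by (intro group_action.intro group_hom.intro group_hom_axioms.intro is_group group_BijGroup)
      (auto simp: hom_def BijGroup_def)
  interpret act: group_action G E \<phi> by (rule act)
  have "stabilizer G \<phi> K \<in> VC G" if K: "K \<in> E" for K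
  proof -
    obtain x where x: "x \<in> carrier G" "K = l_coset G x C" using K by (auto simp: E_def)
    have sub: "subgroup (stabilizer G \<phi> K) G" using act.stabilizer_subgroup[OF K] .
    interpret f: group_hom G G "\<lambda>h. x \<otimes> h \<otimes> inv x"
      using x(1) by unfold_locales (auto simp: hom_def m_assoc mult_inv_cancel_left)
    have gcoset: "l_coset G g C = C" using lcos_m_assoc[OF Cc] subC gC coset_join3[OF g subC gC] by simp
    let ?d = "x \<otimes> g \<otimes> inv x"
    have "\<phi> ?d K = l_coset G (x \<otimes> g) C" using \<phi>[of ?d x] x g by (simp add: m_assoc)
    also have "\<dots> = K" using lcos_m_assoc[OF Cc x(1) g] gcoset x(2) by simp
    finally have d: "?d \<in> stabilizer G \<phi> K" using x g by (simp add: stabilizer_def)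
    have "\<exists>n::int. s = ?d [^] n" if s: "s \<in> stabilizer G \<phi> K" for s
    proof -
      have sc: "s \<in> carrier G" and "\<phi> s K = K" using s by (auto simp: stabilizer_def)
      then have "l_coset G (s \<otimes> x) C = l_coset G x C" using \<phi> x by simp
      moreover have "s \<otimes> x \<in> l_coset G (s \<otimes> x) C"
        using subgroup.one_closed[OF subC] sc x(1) unfolding l_coset_def by force
      ultimately obtain c where "c \<in> C" "s \<otimes> x = x \<otimes> c" by (auto simp: l_coset_def)
      then obtain n :: int where n: "s \<otimes> x = x \<otimes> g [^] n" using C by auto
      have "s = (s \<otimes> x) \<otimes> inv x" using sc x(1) by (simp add: m_assoc)
      then have "s = x \<otimes> g [^] n \<otimes> inv x" using n by simp
      then show ?thesis using f.hom_int_pow[OF g, of n] by auto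
    qed
    then show ?thesis using cyclic_in_VC[OF is_group sub d] by blast
  qed
  moreover have "\<exists>x\<in>carrier G. \<phi> x K = K'" if KK': "K \<in> E" "K' \<in> E" for K K'
  proof -
    obtain y y' where y: "y \<in> carrier G" "K = l_coset G y C" "y' \<in> carrier G" "K' = l_coset G y' C"
      using KK' by (auto simp: E_def)
    have "\<phi> (y' \<otimes> inv y) K = K'" using \<phi>[of "y' \<otimes> inv y" y] y by (simp add: m_assoc)
    then show ?thesis using y by blast
  qed
  ultimately show "(E, \<phi>) \<in> orb_objs G (VC G)"
    unfolding orb_objs_def gsets_def using act CE
    by (auto simp: transitive_action_def transitive_action_axioms_def)
  have "\<phi> g (l_coset G \<one> C) = l_coset G (g \<otimes> \<one>) C" using \<phi> g by blast
  then show "\<phi> g C = C" using one_C g coset_join3[OF g subC gC] by simp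
qed

text \<open>If there were no G-map to \<open>\<Omega>\<close>, then \<open>\<int>[-, \<Omega>]\<close> and its summand \<open>P 0\<close> would vanish at \<open>\<Delta>\<close>, but \<open>P 0\<close>
  maps onto \<open>\<int>\<close> there.\<close>

lemma gmaps_nonempty_of_bredon_FP:
  fixes G :: "'a monoid"
  assumes "bredon_FP TYPE('n) TYPE('w) G F n"
  obtains \<Omega> :: "('a, 'w) gset" where "\<Omega> \<in> gsets G F" "finite (orbits G (fst \<Omega>) (snd \<Omega>))"
    "\<And>\<Delta>. \<Delta> \<in> orb_objs G F \<Longrightarrow> gmaps G \<Delta> \<Omega> \<noteq> {}"
proof -
  have "\<exists>(P :: nat \<Rightarrow> ('a, 'n) orb_module) \<epsilon>. orb_fin_gen_projective TYPE('w) G F (P 0) \<and>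
      (\<forall>\<Delta>\<in>orb_objs G F. \<epsilon> \<Delta> ` carrier (orb_at (P 0) \<Delta>) = carrier (orb_at (orb_const_Z :: ('a, int) orb_module) \<Delta>))"
    using assms unfolding bredon_FP_def
  proof (elim exE conjE, goal_cases)
    case (1 P d \<epsilon>)
    then show ?case by (intro exI[of _ P] exI[of _ \<epsilon>]) auto
  qed
  then obtain P :: "nat \<Rightarrow> ('a, 'n) orb_module" and \<epsilon> where
    fg: "orb_fin_gen_projective TYPE('w) G F (P 0)" and
    surj: "\<And>\<Delta>. \<Delta> \<in> orb_objs G F \<Longrightarrow> \<epsilon> \<Delta> ` carrier (orb_at (P 0) \<Delta>) = carrier (orb_at (orb_const_Z :: ('a, int) orb_module) \<Delta>)"
    by blast
  obtain \<Omega> :: "('a, 'w) gset" and Q :: "('a, ('a set \<Rightarrow> 'w) \<Rightarrow>\<^sub>0 int) orb_module" and \<eta> where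
    \<Omega>: "\<Omega> \<in> gsets G F" "finite (orbits G (fst \<Omega>) (snd \<Omega>))" and
    Q: "is_orb_module G F Q" and \<eta>: "\<eta> \<in> orb_iso G F (orb_sum (P 0) Q) (orb_free G \<Omega>)"
    using fg unfolding orb_fin_gen_projective_def orb_summand_of_free_def by blast
  have "gmaps G \<Delta> \<Omega> \<noteq> {}" if \<Delta>: "\<Delta> \<in> orb_objs G F" for \<Delta>
  proof
    assume empty: "gmaps G \<Delta> \<Omega> = {}"
    have "bij_betw (\<eta> \<Delta>) (carrier (orb_at (orb_sum (P 0) Q) \<Delta>)) (carrier (orb_at (orb_free G \<Omega>) \<Delta>))"
      using \<eta> \<Delta> by (simp add: orb_iso_def)
    moreover have "carrier (orb_at (orb_free G \<Omega>) \<Delta>) = {0}"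
      using empty by (auto simp: orb_free_def free_Abelian_group_def)
    ultimately have bij: "bij_betw (\<eta> \<Delta>) (carrier (orb_at (P 0) \<Delta>) \<times> carrier (orb_at Q \<Delta>)) {0}"
      by (simp add: orb_sum_def)
    interpret Q: comm_group "orb_at Q \<Delta>" using Q \<Delta> unfolding is_orb_module_def by blast
    have "p = p'" if p: "p \<in> carrier (orb_at (P 0) \<Delta>)" "p' \<in> carrier (orb_at (P 0) \<Delta>)" for p p'
    proof -
      have "(p, \<one>\<^bsub>orb_at Q \<Delta>\<^esub>) = (p', \<one>\<^bsub>orb_at Q \<Delta>\<^esub>)"
        using bij_betwE[OF bij] p Q.one_closed by (intro inj_onD[OF bij_betw_imp_inj_on[OF bij]]) auto
      then show ?thesis by simp
    qed
    moreover obtain p p' where "p \<in> carrier (orb_at (P 0) \<Delta>)" "\<epsilon> \<Delta> p = 0" "p' \<in> carrier (orb_at (P 0) \<Delta>)" "\<epsilon> \<Delta> p' = 1"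
    proof -
      have *: "(0::int) \<in> \<epsilon> \<Delta> ` carrier (orb_at (P 0) \<Delta>)" "(1::int) \<in> \<epsilon> \<Delta> ` carrier (orb_at (P 0) \<Delta>)"
        using surj[OF \<Delta>] by (simp_all add: orb_const_Z_def)
      from *(1) obtain p where p: "p \<in> carrier (orb_at (P 0) \<Delta>)" "\<epsilon> \<Delta> p = 0" by (elim imageE) auto
      from *(2) obtain p' where p': "p' \<in> carrier (orb_at (P 0) \<Delta>)" "\<epsilon> \<Delta> p' = 1" by (elim imageE) auto
      show ?thesis by (rule that[OF p p'])
    qed
    ultimately show False by (metis zero_neq_one)
  qed
  then show ?thesis using that \<Omega> by blast
qed

text \<open>The image of the base point under a G-map from \<open>G/\<langle>g\<rangle>\<close> to \<open>\<Omega>\<close> is fixed by \<open>g\<close>.\<close>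

theorem conj_covered_of_bredon_FP:
  fixes G :: "'a monoid" (structure)
  assumes "group G" and "bredon_FP TYPE('n) TYPE('w) G (VC G) n"
  shows "conj_covered G"
proof -
  interpret group G by fact
  obtain \<Omega> :: "('a, 'w) gset" where \<Omega>: "\<Omega> \<in> gsets G (VC G)" "finite (orbits G (fst \<Omega>) (snd \<Omega>))"
    "\<And>\<Delta>. \<Delta> \<in> orb_objs G (VC G) \<Longrightarrow> gmaps G \<Delta> \<Omega> \<noteq> {}"
    using gmaps_nonempty_of_bredon_FP[OF assms(2)] by blast
  obtain U \<psi> where U: "\<Omega> = (U, \<psi>)" by (metis surj_pair)
  interpret U: group_action G U \<psi> using \<Omega>(1) by (simp add: U gsets_def)
  have stab: "stabilizer G \<psi> u \<in> VC G" if "u \<in> U" for u using \<Omega>(1) that by (simp add: U gsets_def)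
  define rep :: "'w set \<Rightarrow> 'w" where "rep Ob = (SOME u. u \<in> Ob)" for Ob
  have rep: "rep Ob \<in> Ob" "rep Ob \<in> U" if Ob: "Ob \<in> orbits G U \<psi>" for Ob
  proof -
    obtain u where "u \<in> U" "Ob = orbit G \<psi> u" using Ob by (auto simp: orbits_def)
    then have "u \<in> Ob" using U.orbit_refl by simp
    then show "rep Ob \<in> Ob" unfolding rep_def by (rule someI)
    then show "rep Ob \<in> U" using U.orbits_coverture Ob by blast
  qed
  define Hs where "Hs = (\<lambda>Ob. stabilizer G \<psi> (rep Ob)) ` orbits G U \<psi>"
  have "\<exists>z\<in>carrier G. \<exists>H\<in>Hs. z \<otimes> g \<otimes> inv z \<in> H" if g: "g \<in> carrier G" for g
  proof -
    define C where "C = generate G {g}"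
    define E where "E = (\<lambda>x. l_coset G x C) ` carrier G"
    define \<phi> where "\<phi> = (\<lambda>x. \<lambda>K\<in>E. l_coset G x K)"
    have orb: "(E, \<phi>) \<in> orb_objs G (VC G)" "C \<in> E" "\<phi> g C = C"
      using coset_orbit[OF is_group g] by (simp_all add: C_def E_def \<phi>_def)
    obtain f where f: "f \<in> gmaps G (E, \<phi>) (U, \<psi>)" using \<Omega>(3)[OF orb(1)] U by blast
    define u where "u = f C"
    have u: "u \<in> U" "\<psi> g u = u"
      using f orb(2,3) g unfolding gmaps_def u_def by (auto dest!: bspec[of _ _ g] bspec[of _ _ C])
    define Ob where "Ob = orbit G \<psi> u"
    have Ob: "Ob \<in> orbits G U \<psi>" using u(1) by (auto simp: Ob_def orbits_def)
    obtain z where z: "z \<in> carrier G" "\<psi> z u = rep Ob" using rep(1)[OF Ob] by (auto simp: Ob_def orbit_def)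
    have "\<psi> (z \<otimes> g \<otimes> inv z) (rep Ob) = rep Ob"
      using z u g U.composition_rule[OF rep(2)[OF Ob], of "z \<otimes> g" "inv z"] U.orbit_sym_aux[OF z(1) u(1) z(2)]
        U.composition_rule[OF u(1) z(1) g] by simp
    then have "z \<otimes> g \<otimes> inv z \<in> stabilizer G \<psi> (rep Ob)" using z g by (simp add: stabilizer_def)
    then show ?thesis using z(1) Ob unfolding Hs_def by blast
  qed
  moreover have "finite Hs" unfolding Hs_def using \<Omega>(2) U by simp
  moreover have "subgroup H G \<and> almost_cyclic G H" if "H \<in> Hs" for H
    using that stab rep(2) almost_cyclic_of_VC[OF is_group] unfolding Hs_def by blast
  ultimately show ?thesis unfolding conj_covered_def by (intro exI[of _ Hs]) blast
qed

theorem theorem5p4: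
  fixes G :: "'a monoid"
  assumes "group G"
    and "abelian_by_polycyclic G"
    and "group_FP TYPE('m) TYPE('b) G 3"
    and "bredon_FP TYPE('n) TYPE('w) G (VC G) 1"
    and "\<forall>g\<in>carrier G. group.ord G g = 0 \<longrightarrow> fin_gen_subgroup (centralizer G g) G"
  shows "virtually_cyclic G"
proof -
  obtain d where "cofinite_mod G d {\<one>\<^bsub>G\<^esub>}"
    using group.conj_covered_solvable[OF assms(1) conj_covered_of_bredon_FP[OF assms(1,4)]
        abelian_by_polycyclic_imp_solvable[OF assms(1,2)]] by blast
  then show ?thesis by (rule virtually_cyclic_of_cofinite_mod[OF assms(1)])
qed

end
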